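(* Assume $\sigma$-projective determinacy. Then every perfect space in $\mathscr{K}$ that is not $\sigma$-compact has a closed subset that is a perfect preimage of $\omega^\omega$.
   Context: Spaces are completely regular. A space is perfect if every closed subset is a $G_\delta$. A perfect map is a continuous closed surjection with compact fibers. $\sigma$-projective sets: sets of reals in $\mathbf{\Sigma}^1_{\omega_1}$ of the transfinite projective hierarchy ($\mathbf{\Sigma}^1_1$ analytic; $\mathbf{\Pi}^1_\xi$ complements; $\mathbf{\Sigma}^1_{\xi+1}$ continuous images of $\mathbf{\Pi}^1_\xi$; at limits, countable unions of earlier levels). $\sigma$-projective determinacy: every length-$\omega$ perfect-information game on $\omega$ with $\sigma$-projective payoff is determined. A multifunction $F:X\to\mathcal{P}(Y)$ is USCCV if each $F(x)$ is compact and $\{x:F(x)\cap C\ne\emptyset\}$ is closed for closed $C$. $\mathscr{K}$ is the class of images of $\sigma$-projective sets under surjective USCCV multifunctions. *)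

theory Defs
  imports "HOL-Analysis.Analysis"
begin

text \<open>The type \<^typ>\<open>nat \<Rightarrow> nat\<close> carries the product topology of discrete spaces,
  so it is the Baire space $\omega^\omega$.\<close>

definition analytic_set :: "'a::topological_space set \<Rightarrow> bool" where
  "analytic_set A \<longleftrightarrow>
     A = {} \<or> (\<exists>f :: (nat \<Rightarrow> nat) \<Rightarrow> 'a. continuous_on UNIV f \<and> A = range f)"

text \<open>A well-order of type $\omega_1$. Since the hierarchy below starts at level 1, the least
  element of this order stands for the ordinal 1; successors and limits are unaffected by the shift.\<close>

definition omega1 :: "nat set rel" where
  "omega1 = cardSuc natLeq"

definition is_least :: "'i rel \<Rightarrow> 'i \<Rightarrow> bool" where
  "is_least r \<xi> \<longleftrightarrow> \<xi> \<in> Field r \<and> underS r \<xi> = {}"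

definition is_succ_of :: "'i rel \<Rightarrow> 'i \<Rightarrow> 'i \<Rightarrow> bool" where
  "is_succ_of r \<xi> \<eta> \<longleftrightarrow> \<xi> \<in> Field r \<and> \<eta> \<in> Field r \<and> underS r \<xi> = under r \<eta>"

definition is_limit :: "'i rel \<Rightarrow> 'i \<Rightarrow> bool" where
  "is_limit r \<xi> \<longleftrightarrow> \<xi> \<in> Field r \<and> \<not> is_least r \<xi> \<and> (\<nexists>\<eta>. is_succ_of r \<xi> \<eta>)"

text \<open>\<open>Sigma1 \<xi> A\<close> says that \<open>A\<close> is in $\mathbf{\Sigma}^1_\xi$, for $1 \le \xi < \omega_1$.
  In the successor rule the premise on \<open>- P\<close> says that \<open>P\<close> is in $\mathbf{\Pi}^1_\eta$.\<close>

inductive Sigma1 :: "nat set \<Rightarrow> 'a::topological_space set \<Rightarrow> bool" where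
  least: "Sigma1 \<xi> A" if "is_least omega1 \<xi>" "analytic_set A"
| succ: "Sigma1 \<xi> (f ` P)"
    if "is_succ_of omega1 \<xi> \<eta>" "Sigma1 \<eta> (- P)" "continuous_on P f"
| limit: "Sigma1 \<xi> (\<Union>n::nat. B n)"
    if "is_limit omega1 \<xi>" "\<And>n. \<exists>\<eta>\<in>underS omega1 \<xi>. Sigma1 \<eta> (B n)"

text \<open>The level $\mathbf{\Sigma}^1_{\omega_1}$, which is given by the limit clause.\<close>

definition sigma_projective :: "'a::topological_space set \<Rightarrow> bool" where
  "sigma_projective A \<longleftrightarrow>
     (\<exists>B :: nat \<Rightarrow> 'a set. (\<forall>n. \<exists>\<xi>\<in>Field omega1. Sigma1 \<xi> (B n)) \<and> A = (\<Union>n. B n))"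

text \<open>A run of the game is \<open>x :: nat \<Rightarrow> nat\<close>: player I chooses the even-indexed entries, player II
  the odd-indexed ones, and I wins iff \<open>x\<close> is in the payoff set. A strategy maps the finite
  sequence of all previous moves to the next move.\<close>

definition winning_I :: "(nat \<Rightarrow> nat) set \<Rightarrow> (nat list \<Rightarrow> nat) \<Rightarrow> bool" where
  "winning_I A s \<longleftrightarrow> (\<forall>x. (\<forall>n. x (2 * n) = s (map x [0..<2 * n])) \<longrightarrow> x \<in> A)"

definition winning_II :: "(nat \<Rightarrow> nat) set \<Rightarrow> (nat list \<Rightarrow> nat) \<Rightarrow> bool" where
  "winning_II A t \<longleftrightarrow> (\<forall>x. (\<forall>n. x (2 * n + 1) = t (map x [0..<2 * n + 1])) \<longrightarrow> x \<notin> A)"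

definition determined :: "(nat \<Rightarrow> nat) set \<Rightarrow> bool" where
  "determined A \<longleftrightarrow> (\<exists>s. winning_I A s) \<or> (\<exists>t. winning_II A t)"

definition sigma_projective_determinacy :: bool where
  "sigma_projective_determinacy \<longleftrightarrow>
     (\<forall>A :: (nat \<Rightarrow> nat) set. sigma_projective A \<longrightarrow> determined A)"

definition USCCV :: "'b topology \<Rightarrow> 'a topology \<Rightarrow> ('b \<Rightarrow> 'a set) \<Rightarrow> bool" where
  "USCCV X Y F \<longleftrightarrow>
     (\<forall>x\<in>topspace X. compactin Y (F x)) \<and>
     (\<forall>C. closedin Y C \<longrightarrow> closedin X {x \<in> topspace X. F x \<inter> C \<noteq> {}})"

definition in_class_K :: "'a topology \<Rightarrow> bool" where
  "in_class_K X \<longleftrightarrow>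
     (\<exists>(A :: real set) F. sigma_projective A \<and> USCCV (top_of_set A) X F \<and>
        (\<Union>a\<in>A. F a) = topspace X)"

definition perfect_space :: "'a topology \<Rightarrow> bool" where
  "perfect_space X \<longleftrightarrow> (\<forall>C. closedin X C \<longrightarrow> gdelta_in X C)"

definition sigma_compact_space :: "'a topology \<Rightarrow> bool" where
  "sigma_compact_space X \<longleftrightarrow>
     (\<exists>K :: nat \<Rightarrow> 'a set. (\<forall>n. compactin X (K n)) \<and> (\<Union>n. K n) = topspace X)"

end

theory Submission
  imports Defs "HOL-Library.Countable_Set_Type"
begin

text \<open>
  The space is an upper semicontinuous compact-valued image \<open>F[Y]\<close> of a sigma-projective
  \<open>Y \<subseteq> \<omega>\<^sup>\<omega>\<close>. Fix a continuous map \<open>g\<close> into a compact metrizable space.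
  In a Hurewicz-type game, player I proposes a sequence of disjoint closed sets, taken from the
  countable family generated by \<open>g\<close> and shrinking to a point outside the image; player II either
  refuses or accepts the current one. After an acceptance player I adds a digit to a point of \<open>Y\<close>
  and continues inside the accepted set. Player I has to end up in \<open>Y\<close> if there are infinitely
  many acceptances, and with sets of empty intersection otherwise. The payoff is sigma-projective. A
  winning strategy of player I yields a closed perfect preimage of \<open>\<omega>\<^sup>\<omega>\<close>; one of player II shows
  that the image of \<open>g\<close> is sigma-compact.

  It remains to see that the space is sigma-compact if all of its metrizable images are. Since it is
  hereditarily Lindelof, the closures of the sets \<open>F[N\<^sub>t]\<close>, for the basic open sets \<open>N\<^sub>t\<close>, are preimages
  of closed sets under a single map \<open>g\<close> into the Hilbert cube, and this \<open>g\<close> has compact fibres. If the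
  space were not sigma-compact, one could build a tree of closed sets that are not sigma-compact and
  have compact \<open>g\<close>-images, together with continuous functions witnessing that the successors of
  each node escape to infinity. All branches of the tree have common points, so those functions
  define a metrizable image that is not sigma-compact.
\<close>


section \<open>The order type omega one\<close>

lemma Well_order_omega1: "Well_order omega1"
  by (simp add: omega1_def cardSuc_Well_order natLeq_Card_order)

context includes cardinal_syntax begin

lemma uncountable_Field_omega1: "uncountable (Field omega1)"
proof
  assume "countable (Field omega1)"
  then have "|Field omega1| \<le>o natLeq"
    by (simp add: countable_card_le_natLeq)
  moreover have "|Field omega1| =o omega1"
    by (simp add: omega1_def cardSuc_Card_order card_of_Field_ordIso natLeq_Card_order)
  ultimately have "omega1 \<le>o natLeq"
    using ordIso_ordLeq_trans ordIso_symmetric by blast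
  then show False
    using cardSuc_greater[OF natLeq_Card_order] not_ordLess_ordLeq omega1_def by metis
qed

lemma countable_under_omega1:
  assumes "\<xi> \<in> Field omega1"
  shows "countable (under omega1 \<xi>)"
proof -
  have "|underS omega1 \<xi>| <o omega1"
    using assms by (simp add: omega1_def cardSuc_Card_order card_of_underS natLeq_Card_order)
  then have "countable (underS omega1 \<xi>)"
    by (metis omega1_def card_of_Card_order cardSuc_ordLeq_ordLess countable_card_le_natLeq
        natLeq_Card_order)
  moreover have "under omega1 \<xi> \<subseteq> insert \<xi> (underS omega1 \<xi>)"
    by (auto simp: under_def underS_def)
  ultimately show ?thesis
    by (meson countable_insert countable_subset)
qed

end

text \<open>The least element outside \<open>S\<close> does it; one exists because
  \<open>Field omega1\<close> is uncountable. Successors and limits are all obtained this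
  way.\<close>

lemma omega1_initial_segment:
  assumes "countable S" "S \<subseteq> Field omega1"
    and down: "\<And>\<eta> \<zeta>. \<zeta> \<in> S \<Longrightarrow> (\<eta>, \<zeta>) \<in> omega1 \<Longrightarrow> \<eta> \<in> S"
  obtains \<xi> where "\<xi> \<in> Field omega1" "underS omega1 \<xi> = S"
proof -
  interpret w: wo_rel omega1
    by (simp add: wo_rel_def Well_order_omega1)
  have ne: "Field omega1 - S \<noteq> {}"
    using assms(1) uncountable_Field_omega1 countable_subset by (metis Diff_eq_empty_iff)
  define \<xi> where "\<xi> = w.minim (Field omega1 - S)"
  have \<xi>: "\<xi> \<in> Field omega1 - S"
    unfolding \<xi>_def by (rule w.minim_in) (use ne in auto)
  have least: "(\<xi>, \<eta>) \<in> omega1" if "\<eta> \<in> Field omega1 - S" for \<eta>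
    unfolding \<xi>_def by (rule w.minim_least) (use that in auto)
  have "underS omega1 \<xi> \<subseteq> S"
  proof
    fix \<eta> assume \<eta>: "\<eta> \<in> underS omega1 \<xi>"
    then have "(\<eta>, \<xi>) \<in> omega1" "\<eta> \<noteq> \<xi>" "\<eta> \<in> Field omega1"
      by (auto simp: underS_def Field_def)
    then show "\<eta> \<in> S"
      using least w.ANTISYM by (meson DiffI antisymD)
  qed
  moreover have "S \<subseteq> underS omega1 \<xi>"
  proof
    fix \<eta> assume \<eta>: "\<eta> \<in> S"
    then have "\<eta> \<noteq> \<xi>" using \<xi> by auto
    moreover have "(\<eta>, \<xi>) \<in> omega1 \<or> (\<xi>, \<eta>) \<in> omega1"
      using w.TOTALS \<eta> \<xi> assms(2) by blast
    ultimately show "\<eta> \<in> underS omega1 \<xi>"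
      using down[OF \<eta>] \<xi> by (auto simp: underS_def)
  qed
  ultimately show thesis
    using that \<xi> by blast
qed

lemma omega1_trans: "(\<xi>, \<eta>) \<in> omega1 \<Longrightarrow> (\<eta>, \<zeta>) \<in> omega1 \<Longrightarrow> (\<xi>, \<zeta>) \<in> omega1"
  using wo_rel.TRANS[of omega1] by (meson Well_order_omega1 transD wo_rel_def)

lemma omega1_refl: "\<xi> \<in> Field omega1 \<Longrightarrow> (\<xi>, \<xi>) \<in> omega1"
  using wo_rel.REFL[of omega1] by (meson Well_order_omega1 refl_onD wo_rel_def)

lemma ex_is_least_omega1: "\<exists>\<xi>. is_least omega1 \<xi>"
  using omega1_initial_segment[of "{}"] unfolding is_least_def by auto

lemma ex_is_succ_of_omega1:
  assumes "\<eta> \<in> Field omega1"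
  shows "\<exists>\<xi>. is_succ_of omega1 \<xi> \<eta>"
proof -
  obtain \<xi> where "\<xi> \<in> Field omega1" "underS omega1 \<xi> = under omega1 \<eta>"
    using omega1_initial_segment[of "under omega1 \<eta>"] countable_under_omega1[OF assms]
    by (smt (verit, best) Field_def UnI1 mem_Collect_eq omega1_trans subsetI under_def Domain.DomainI)
  then show ?thesis
    using assms by (auto simp: is_succ_of_def)
qed

text \<open>A countable union has to be placed at a limit level above all levels involved. Closing
  these levels under successors yields such a limit.\<close>

lemma ex_is_limit_omega1:
  fixes \<xi> :: "nat \<Rightarrow> nat set"
  assumes \<xi>: "\<And>n. \<xi> n \<in> Field omega1"
  obtains \<zeta> where "is_limit omega1 \<zeta>" "\<And>n. \<xi> n \<in> underS omega1 \<zeta>"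
proof -
  obtain sc where sc: "\<And>\<eta>. \<eta> \<in> Field omega1 \<Longrightarrow> is_succ_of omega1 (sc \<eta>) \<eta>"
    using ex_is_succ_of_omega1 by metis
  have fld: "(sc ^^ k) (\<xi> n) \<in> Field omega1" for k n
    by (induction k) (use \<xi> sc in \<open>auto simp: is_succ_of_def\<close>)
  define S where "S = (\<Union>n k. under omega1 ((sc ^^ k) (\<xi> n)))"
  have "countable S"
    unfolding S_def using countable_under_omega1 fld by (intro countable_UN) auto
  moreover have "S \<subseteq> Field omega1"
    by (auto simp: S_def under_def Field_def)
  moreover have down: "\<eta> \<in> S" if "\<zeta> \<in> S" "(\<eta>, \<zeta>) \<in> omega1" for \<eta> \<zeta>
    using that omega1_trans by (auto simp: S_def under_def) blast
  ultimately obtain \<zeta> where \<zeta>: "\<zeta> \<in> Field omega1" "underS omega1 \<zeta> = S"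
    using omega1_initial_segment by metis
  have \<xi>S: "\<xi> n \<in> S" for n
  proof -
    have "\<xi> n \<in> under omega1 ((sc ^^ 0) (\<xi> n))"
      using omega1_refl[OF \<xi>, of n] by (simp add: under_def)
    then show ?thesis unfolding S_def by blast
  qed
  \<comment> \<open>A predecessor \<eta> would lie below some iterate \<mu>, while the successor of
    \<mu>, also in \<open>S\<close>, lies below \<eta>; so it would lie below \<mu>.\<close>
  have "\<not> is_succ_of omega1 \<zeta> \<eta>" for \<eta>
  proof
    assume s: "is_succ_of omega1 \<zeta> \<eta>"
    then have \<eta>: "\<eta> \<in> Field omega1" and eq: "S = under omega1 \<eta>"
      using \<zeta> by (auto simp: is_succ_of_def)
    have "\<eta> \<in> S"
      using eq omega1_refl[OF \<eta>] by (auto simp: under_def)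
    then obtain n k where nk: "(\<eta>, (sc ^^ k) (\<xi> n)) \<in> omega1"
      by (auto simp: S_def under_def)
    let ?\<mu> = "(sc ^^ k) (\<xi> n)"
    have *: "is_succ_of omega1 (sc ?\<mu>) ?\<mu>"
      using sc fld by blast
    have "(sc ^^ Suc k) (\<xi> n) \<in> S"
      unfolding S_def using omega1_refl[OF fld[of "Suc k" n]] under_def by fast
    then have "sc ?\<mu> \<in> S" by simp
    then have "(sc ?\<mu>, \<eta>) \<in> omega1"
      using eq by (auto simp: under_def)
    then have 1: "(sc ?\<mu>, ?\<mu>) \<in> omega1"
      using nk omega1_trans by blast
    then have "sc ?\<mu> \<in> underS omega1 (sc ?\<mu>)"
      using * by (auto simp: is_succ_of_def under_def)
    then show False by (simp add: underS_def)
  qed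
  then have "is_limit omega1 \<zeta>"
    using \<zeta> \<xi>S by (auto simp: is_limit_def is_least_def)
  then show thesis
    using that \<zeta> \<xi>S by auto
qed

section \<open>Topology of Baire space\<close>

lemma open_baire_iff:
  fixes U :: "(nat \<Rightarrow> nat) set"
  shows "open U \<longleftrightarrow> (\<forall>x\<in>U. \<exists>n. \<forall>y. (\<forall>i<n. y i = x i) \<longrightarrow> y \<in> U)"
proof
  assume U: "open U"
  show "\<forall>x\<in>U. \<exists>n. \<forall>y. (\<forall>i<n. y i = x i) \<longrightarrow> y \<in> U"
  proof
    fix x assume x: "x \<in> U"
    have "openin (product_topology (\<lambda>i. euclidean) UNIV) U"
      using U by (simp add: euclidean_product_topology)
    from product_topology_open_contains_basis[OF this x]
    obtain V where V: "x \<in> Pi\<^sub>E UNIV V" "finite {i. V i \<noteq> UNIV}" "Pi\<^sub>E UNIV V \<subseteq> U"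
      by auto
    from V(2) obtain n where n: "\<And>i. V i \<noteq> UNIV \<Longrightarrow> i < n"
      unfolding finite_nat_set_iff_bounded by blast
    have "y \<in> U" if "\<forall>i<n. y i = x i" for y
    proof -
      have "y i \<in> V i" for i
        using that n[of i] V(1) by (cases "V i = UNIV") (auto simp: PiE_iff)
      then show ?thesis using V(3) by (auto simp: PiE_iff)
    qed
    then show "\<exists>n. \<forall>y. (\<forall>i<n. y i = x i) \<longrightarrow> y \<in> U" by blast
  qed
next
  assume *: "\<forall>x\<in>U. \<exists>n. \<forall>y. (\<forall>i<n. y i = x i) \<longrightarrow> y \<in> U"
  show "open U"
  proof (subst open_subopen, intro ballI)
    fix x assume "x \<in> U"
    then obtain n where n: "\<And>y. (\<forall>i<n. y i = x i) \<Longrightarrow> y \<in> U"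
      using * by blast
    have "open {y. \<forall>i\<in>{..<n}. y i \<in> {x i}}"
      by (rule product_topology_basis') (auto simp: open_discrete)
    then show "\<exists>T. open T \<and> x \<in> T \<and> T \<subseteq> U"
      using n by (intro exI[of _ "{y. \<forall>i\<in>{..<n}. y i \<in> {x i}}"]) auto
  qed
qed

text \<open>A violation of clause \<open>n\<close> is seen on the first \<open>N n\<close> entries,
  so the complement is open.\<close>

lemma closed_baire_Collect_all:
  fixes R :: "nat \<Rightarrow> (nat \<Rightarrow> nat) \<Rightarrow> bool"
  assumes "\<And>n x y. (\<And>i. i < N n \<Longrightarrow> x i = y i) \<Longrightarrow> R n x \<Longrightarrow> R n y"
  shows "closed {x. \<forall>n. R n x}"
proof -
  have "open (- {x. \<forall>n. R n x})"
    unfolding open_baire_iff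
  proof
    fix x assume "x \<in> - {x. \<forall>n. R n x}"
    then obtain n where n: "\<not> R n x" by blast
    then have "\<not> R n y" if "\<forall>i<N n. y i = x i" for y
      using assms[of n y x] that by blast
    then show "\<exists>n. \<forall>y. (\<forall>i<n. y i = x i) \<longrightarrow> y \<in> - {x. \<forall>n. R n x}"
      by blast
  qed
  then show ?thesis by (simp add: closed_def)
qed

lemma continuous_on_evens: "continuous_on UNIV (\<lambda>(x::nat \<Rightarrow> nat) n. x (2 * n))"
  and continuous_on_odds: "continuous_on UNIV (\<lambda>(x::nat \<Rightarrow> nat) n. x (2 * n + 1))"
  by (intro continuous_on_coordinatewise_then_product continuous_on_product_coordinates)+

definition interleave :: "(nat \<Rightarrow> nat) \<Rightarrow> (nat \<Rightarrow> nat) \<Rightarrow> nat \<Rightarrow> nat" where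
  "interleave x y n = (if even n then x (n div 2) else y (n div 2))"

lemma interleave_simps [simp]:
  "interleave x y (2 * n) = x n" "interleave x y (Suc (2 * n)) = y n"
  by (auto simp: interleave_def)

section \<open>Levels of the projective hierarchy\<close>

text \<open>Forgetting the level loses nothing: by \<open>sigma_projective_iff\<close> this is again
  sigma-projectivity, since countably many levels have a common bound in
  \<open>Field omega1\<close>.\<close>

definition in_hierarchy :: "'a::topological_space set \<Rightarrow> bool" where
  "in_hierarchy B \<longleftrightarrow> (\<exists>\<xi>. Sigma1 \<xi> B)"

lemma Sigma1_Field: "Sigma1 \<xi> B \<Longrightarrow> \<xi> \<in> Field omega1"
  by (erule Sigma1.cases) (auto simp: is_least_def is_succ_of_def is_limit_def)

lemma in_hierarchy_analytic: "analytic_set B \<Longrightarrow> in_hierarchy B"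
  using ex_is_least_omega1 Sigma1.least unfolding in_hierarchy_def by blast

lemma in_hierarchy_Compl:
  assumes "in_hierarchy B" shows "in_hierarchy (- B)"
proof -
  obtain \<eta> where \<eta>: "Sigma1 \<eta> B" using assms in_hierarchy_def by blast
  then obtain \<xi> where "is_succ_of omega1 \<xi> \<eta>"
    using ex_is_succ_of_omega1 Sigma1_Field by blast
  then have "Sigma1 \<xi> ((\<lambda>x. x) ` (- B))"
    using \<eta> by (intro Sigma1.succ) auto
  then show ?thesis
    unfolding in_hierarchy_def by auto
qed

text \<open>The successor rule takes images of sets whose complement has a level, so the complement
  of \<open>B\<close> is placed in the hierarchy first.\<close>

lemma in_hierarchy_image:
  fixes f :: "'a::topological_space \<Rightarrow> 'a"
  assumes "in_hierarchy B" "continuous_on B f" shows "in_hierarchy (f ` B)"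
proof -
  obtain \<eta> where \<eta>: "Sigma1 \<eta> (- B)"
    using in_hierarchy_Compl[OF assms(1)] in_hierarchy_def by blast
  then obtain \<xi> where "is_succ_of omega1 \<xi> \<eta>"
    using ex_is_succ_of_omega1 Sigma1_Field by blast
  then show ?thesis
    using \<eta> assms(2) Sigma1.succ unfolding in_hierarchy_def by blast
qed

lemma in_hierarchy_UN_nat:
  fixes B :: "nat \<Rightarrow> 'a::topological_space set"
  assumes "\<And>n. in_hierarchy (B n)" shows "in_hierarchy (\<Union>n. B n)"
proof -
  obtain \<xi> where \<xi>: "\<And>n. Sigma1 (\<xi> n) (B n)"
    using assms unfolding in_hierarchy_def by metis
  obtain \<zeta> where "is_limit omega1 \<zeta>" "\<And>n. \<xi> n \<in> underS omega1 \<zeta>"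
    using ex_is_limit_omega1[of \<xi>] \<xi> Sigma1_Field by metis
  then show ?thesis
    unfolding in_hierarchy_def using \<xi> Sigma1.limit by blast
qed

lemma sigma_projective_iff: "sigma_projective B \<longleftrightarrow> in_hierarchy B"
proof
  assume "sigma_projective B"
  then show "in_hierarchy B"
    unfolding sigma_projective_def
    using in_hierarchy_UN_nat in_hierarchy_def by metis
next
  assume "in_hierarchy B"
  then show "sigma_projective B"
    unfolding sigma_projective_def in_hierarchy_def
    by (auto intro!: exI[of _ "\<lambda>_. B"] dest: Sigma1_Field)
qed

lemma in_hierarchy_UN:
  assumes "countable I" "\<And>i. i \<in> I \<Longrightarrow> in_hierarchy (B i)" shows "in_hierarchy (\<Union>i\<in>I. B i)"
proof (cases "I = {}")
  case True
  then show ?thesis by (simp add: in_hierarchy_analytic analytic_set_def)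
next
  case False
  have "B ` I = (\<lambda>n. B (from_nat_into I n)) ` UNIV"
    using range_from_nat_into[OF False assms(1)] by (metis image_image)
  then show ?thesis
    using in_hierarchy_UN_nat[of "\<lambda>n. B (from_nat_into I n)"] assms(2) from_nat_into[OF False]
    by simp
qed

lemma in_hierarchy_Un: "in_hierarchy A \<Longrightarrow> in_hierarchy B \<Longrightarrow> in_hierarchy (A \<union> B)"
  using in_hierarchy_UN[of "{A, B}" "\<lambda>x. x"] by auto

lemma in_hierarchy_Int: "in_hierarchy A \<Longrightarrow> in_hierarchy B \<Longrightarrow> in_hierarchy (A \<inter> B)"
  using in_hierarchy_Compl[OF in_hierarchy_Un[OF in_hierarchy_Compl in_hierarchy_Compl], of A B]
  by simp

lemma in_hierarchy_INT_nat:
  "(\<And>n::nat. in_hierarchy (B n)) \<Longrightarrow> in_hierarchy (\<Inter>n. B n)"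
  using in_hierarchy_Compl[OF in_hierarchy_UN_nat[of "\<lambda>n. - B n", OF in_hierarchy_Compl]] by simp

lemma in_hierarchy_cylinder:
  fixes s :: "nat list"
  shows "in_hierarchy {x::nat \<Rightarrow> nat. \<forall>i<length s. x i = s ! i}"
proof -
  \<comment> \<open>A continuous retraction of Baire space onto the cylinder, which is therefore
    analytic.\<close>
  let ?f = "\<lambda>(x::nat \<Rightarrow> nat) i. if i < length s then s ! i else x i"
  have "continuous_on UNIV ?f"
  proof (intro continuous_on_coordinatewise_then_product)
    show "continuous_on UNIV (\<lambda>x. ?f x i)" for i
      by (cases "i < length s") auto
  qed
  moreover have "x \<in> range ?f" if "\<forall>i<length s. x i = s ! i" for x
    using that by (intro image_eqI[of _ _ x]) auto
  ultimately show ?thesis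
    by (intro in_hierarchy_analytic) (auto simp: analytic_set_def intro!: exI[of _ ?f])
qed

lemma in_hierarchy_open:
  fixes U :: "(nat \<Rightarrow> nat) set"
  assumes "open U" shows "in_hierarchy U"
proof -
  let ?N = "\<lambda>s::nat list. {x::nat \<Rightarrow> nat. \<forall>i<length s. x i = s ! i}"
  have "U \<subseteq> (\<Union>s\<in>{s. ?N s \<subseteq> U}. ?N s)"
  proof
    fix x assume "x \<in> U"
    then obtain n where n: "\<And>y. (\<forall>i<n. y i = x i) \<Longrightarrow> y \<in> U"
      using assms open_baire_iff by metis
    then have "?N (map x [0..<n]) \<subseteq> U" "x \<in> ?N (map x [0..<n])" by auto
    then show "x \<in> (\<Union>s\<in>{s. ?N s \<subseteq> U}. ?N s)" by blast
  qed
  then have "U = (\<Union>s\<in>{s. ?N s \<subseteq> U}. ?N s)" by blast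
  then show ?thesis
    using in_hierarchy_UN[of "{s. ?N s \<subseteq> U}" ?N] in_hierarchy_cylinder by simp
qed

lemma in_hierarchy_closed: "closed C \<Longrightarrow> in_hierarchy (C :: (nat \<Rightarrow> nat) set)"
  using in_hierarchy_Compl[OF in_hierarchy_open] by (metis double_complement open_Compl)

section \<open>A continuous surjection from Baire space onto the reals\<close>

text \<open>Truncating the corrections makes the series in \<open>baire_to_real\<close> converge
  uniformly over all sequences of codes of rationals.\<close>

definition clamp_seq :: "nat \<Rightarrow> real \<Rightarrow> real" where
  "clamp_seq n v = max (- ((1/2) ^ n)) (min ((1/2) ^ n) v)"

definition baire_to_real :: "(nat \<Rightarrow> nat) \<Rightarrow> real" where
  "baire_to_real x =
     real_of_rat (from_nat (x 0)) + (\<Sum>n. clamp_seq n (real_of_rat (from_nat (x (Suc n)))))"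

lemma abs_clamp_seq: "\<bar>clamp_seq n v\<bar> \<le> (1/2) ^ n"
proof -
  have "(0::real) \<le> (1/2) ^ n" by simp
  then show ?thesis unfolding clamp_seq_def by linarith
qed

lemma continuous_on_baire_to_real: "continuous_on UNIV baire_to_real"
proof -
  have coord: "continuous_on UNIV (\<lambda>x::nat \<Rightarrow> nat. h (x n))" for h :: "nat \<Rightarrow> real" and n
    using continuous_on_compose2[of UNIV h UNIV "\<lambda>x::nat \<Rightarrow> nat. x n"]
      continuous_on_product_coordinates[of n] by auto
  have "uniform_limit UNIV (\<lambda>n x. \<Sum>i<n. clamp_seq i (real_of_rat (from_nat (x (Suc i)))))
     (\<lambda>x. \<Sum>i. clamp_seq i (real_of_rat (from_nat (x (Suc i))))) sequentially"
    by (rule Weierstrass_m_test[where M = "\<lambda>n. (1/2) ^ n"])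
      (auto simp: abs_clamp_seq intro!: summable_geometric)
  then have "continuous_on UNIV (\<lambda>x. \<Sum>i. clamp_seq i (real_of_rat (from_nat (x (Suc i)))))"
    by (rule uniform_limit_theorem[rotated])
      (auto intro!: always_eventually continuous_on_sum coord)
  then show ?thesis
    unfolding baire_to_real_def by (intro continuous_on_add coord)
qed

lemma surj_baire_to_real: "surj baire_to_real"
proof -
  have dense: "\<exists>m. \<bar>r - real_of_rat (from_nat m)\<bar> < e" if "e > 0" for r e :: real
  proof -
    have "r - e < r + e" using that by simp
    then obtain q where "r - e < real_of_rat q" "real_of_rat q < r + e"
      using of_rat_dense by blast
    then show ?thesis
      by (intro exI[of _ "to_nat q"]) auto
  qed
  define d where "d = (\<lambda>(n::nat) r. SOME m. \<bar>r - real_of_rat (from_nat m)\<bar> < (1/2) ^ Suc n)"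
  have d: "\<bar>r - real_of_rat (from_nat (d n r))\<bar> < (1/2) ^ Suc n" for r :: real and n
    unfolding d_def by (rule someI_ex) (rule dense, simp)
  have "\<exists>x. baire_to_real x = r" for r
  proof -
    define m0 where "m0 = d 0 r"
    \<comment> \<open>\<open>R n\<close> is the error left after the first approximation and
      \<open>n\<close> corrections; each correction is a rational close to the previous
      error.\<close>
    define R where "R = rec_nat (r - real_of_rat (from_nat m0))
      (\<lambda>n R. R - real_of_rat (from_nat (d (Suc n) R)))"
    define x where "x = (\<lambda>n. case n of 0 \<Rightarrow> m0 | Suc n \<Rightarrow> d (Suc n) (R n))"
    have R0: "R 0 = r - real_of_rat (from_nat m0)"
      and RS: "R (Suc n) = R n - real_of_rat (from_nat (x (Suc n)))" for n
      by (simp_all add: R_def x_def)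
    have R: "\<bar>R n\<bar> < (1/2) ^ Suc n" for n
    proof (cases n)
      case 0
      then show ?thesis using d[of r 0] by (simp add: R0 m0_def)
    next
      case (Suc k)
      then show ?thesis using d[of "R k" "Suc k"] by (simp add: RS x_def)
    qed
    have q: "\<bar>real_of_rat (from_nat (x (Suc n)))\<bar> \<le> (1/2) ^ n" for n
    proof -
      have "\<bar>real_of_rat (from_nat (x (Suc n)))\<bar> \<le> \<bar>R n\<bar> + \<bar>R (Suc n)\<bar>"
        unfolding RS by linarith
      also have "\<dots> \<le> (1/2) ^ Suc n + (1/2) ^ Suc n"
        using R[of n] R[of "Suc n"] power_decreasing[of "Suc n" "Suc (Suc n)" "1/2::real"] by simp
      finally show ?thesis by simp
    qed
    \<comment> \<open>The chosen corrections are so small that truncation leaves them unchanged;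
      hence the series telescopes.\<close>
    have cl: "clamp_seq n (real_of_rat (from_nat (x (Suc n)))) = R n - R (Suc n)" for n
      using q[of n] unfolding clamp_seq_def RS by linarith
    have "(\<lambda>n. (1/2::real) ^ Suc n) \<longlonglongrightarrow> 0"
      using LIMSEQ_Suc[OF LIMSEQ_realpow_zero[of "1/2"]] by simp
    then have "R \<longlonglongrightarrow> 0"
      by (rule Lim_null_comparison[rotated]) (auto intro!: always_eventually less_imp_le[OF R] simp del: power_Suc)
    then have "(\<lambda>n. R n - R (Suc n)) sums (R 0 - 0)"
      by (rule telescope_sums')
    then have "baire_to_real x = r"
      unfolding baire_to_real_def cl using sums_unique[of "\<lambda>n. R n - R (Suc n)" "R 0"]
      by (simp add: R0 x_def)
    then show ?thesis by blast
  qed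
  then show ?thesis by (intro surjI) (rule someI_ex)
qed

section \<open>Preimages and projections\<close>

lemma in_hierarchy_evens_image:
  assumes "in_hierarchy P"
  shows "in_hierarchy ((\<lambda>(x::nat \<Rightarrow> nat) n. x (2 * n)) ` P)"
  by (rule in_hierarchy_image[OF assms]) (rule continuous_on_subset[OF continuous_on_evens], simp)

text \<open>The successor rule stays within one type. Pairs are therefore coded by interleaving, and
  a projection becomes the image under taking the even-indexed entries.\<close>

lemma evens_image_eq:
  "(\<lambda>(x::nat \<Rightarrow> nat) n. x (2 * n)) ` {z. Q (\<lambda>n. z (2 * n)) (\<lambda>n. z (2 * n + 1))}
     = {x. \<exists>y. Q x y}"
proof -
  have "x \<in> (\<lambda>(x::nat \<Rightarrow> nat) n. x (2 * n)) ` {z. Q (\<lambda>n. z (2 * n)) (\<lambda>n. z (2 * n + 1))}"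
    if "Q x y" for x y
    using that by (intro image_eqI[of _ _ "interleave x y"]) auto
  then show ?thesis by auto
qed

text \<open>Parametrising the reals by Baire space lets the existential quantifier over a real in the
  successor step be absorbed into a projection of Baire space.\<close>

lemma in_hierarchy_vimage_real:
  fixes A :: "real set"
  assumes "Sigma1 \<xi> A" "continuous_on UNIV \<phi>"
  shows "in_hierarchy (\<phi> -` A :: (nat \<Rightarrow> nat) set)"
  using assms
proof (induction arbitrary: \<phi> rule: Sigma1.induct)
  case (least \<xi> A)
  show ?case
  proof (cases "A = {}")
    case True
    then show ?thesis by (simp add: in_hierarchy_analytic analytic_set_def)
  next
    case False
    then obtain f :: "(nat \<Rightarrow> nat) \<Rightarrow> real" where f: "continuous_on UNIV f" "A = range f"
      using least analytic_set_def by blast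
    have "closed {z. \<phi> (\<lambda>n. z (2 * n)) = f (\<lambda>n. z (2 * n + 1))}"
      by (intro closed_Collect_eq continuous_on_compose2[OF least.prems]
          continuous_on_compose2[OF f(1)] continuous_on_evens continuous_on_odds) auto
    then have "in_hierarchy {x. \<exists>y. \<phi> x = f y}"
      using in_hierarchy_evens_image[OF in_hierarchy_closed] 
      by (simp only: evens_image_eq[of "\<lambda>x y. \<phi> x = f y", symmetric])
    moreover have "\<phi> -` A = {x. \<exists>y. \<phi> x = f y}" using f(2) by auto
    ultimately show ?thesis by simp
  qed
next
  case (succ \<xi> \<eta> P f)
  let ?o = "\<lambda>(z::nat \<Rightarrow> nat) n. z (2 * n + 1)"
  let ?e = "\<lambda>(z::nat \<Rightarrow> nat) n. z (2 * n)"
  have co: "continuous_on UNIV (\<lambda>z. baire_to_real (?o z))"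
    by (rule continuous_on_compose2[OF continuous_on_baire_to_real continuous_on_odds]) auto
  define S where "S = {z. baire_to_real (?o z) \<in> P}"
  \<comment> \<open>The induction hypothesis is about \<open>- P\<close>, so its preimage is
    complemented.\<close>
  have "in_hierarchy (- ((\<lambda>z. baire_to_real (?o z)) -` (- P)))"
    by (intro in_hierarchy_Compl succ.IH co)
  then have S: "in_hierarchy S"
    by (simp add: S_def vimage_def Compl_eq)
  \<comment> \<open>As \<open>f\<close> is continuous on \<open>P\<close> only, the equation defines
    a set that is closed relative to \<open>S\<close>.\<close>
  define E where "E = {z \<in> S. \<phi> (?e z) - f (baire_to_real (?o z)) = 0}"
  have c1: "continuous_on S (\<lambda>z. f (baire_to_real (?o z)))"
    by (rule continuous_on_compose2[OF succ.hyps(3) continuous_on_subset[OF co]])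
      (auto simp: S_def)
  have c2: "continuous_on S (\<lambda>z. \<phi> (?e z))"
    by (rule continuous_on_compose2[OF succ.prems continuous_on_subset[OF continuous_on_evens]])
      auto
  have "closedin (top_of_set S) E"
    using continuous_closedin_preimage[OF continuous_on_diff[OF c2 c1], of "{0}"]
    unfolding E_def by (rule back_subst[of "closedin (top_of_set S)"]) auto
  then obtain C where "closed C" "E = S \<inter> C"
    by (auto simp: closedin_closed)
  then have "in_hierarchy E"
    using S in_hierarchy_Int in_hierarchy_closed by blast
  then have "in_hierarchy (?e ` E)"
    by (rule in_hierarchy_evens_image)
  moreover have "?e ` E = {x. \<exists>y. baire_to_real y \<in> P \<and> \<phi> x = f (baire_to_real y)}"
    using evens_image_eq[of "\<lambda>x y. baire_to_real y \<in> P \<and> \<phi> x = f (baire_to_real y)"]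
    by (simp add: E_def S_def)
  moreover have "{x. \<exists>y. baire_to_real y \<in> P \<and> \<phi> x = f (baire_to_real y)} = \<phi> -` (f ` P)"
  proof safe
    fix x p assume "\<phi> x = f p" "p \<in> P"
    moreover obtain y where "p = baire_to_real y"
      using surjD[OF surj_baire_to_real] by blast
    ultimately show "\<exists>y. baire_to_real y \<in> P \<and> \<phi> x = f (baire_to_real y)" by blast
  qed auto
  ultimately show ?case by simp
next
  case (limit \<xi> B)
  have "in_hierarchy (\<phi> -` B n)" for n
    using limit by blast
  then have "in_hierarchy (\<Union>n. \<phi> -` B n)"
    by (rule in_hierarchy_UN_nat)
  then show ?case by (simp add: vimage_UN)
qed

text \<open>This is how the sigma-projectivity of \<open>A\<close> enters the game: a preimage of
  \<open>A\<close> is intersected with a closed set and then projected.\<close>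

lemma in_hierarchy_projection:
  fixes A :: "real set"
  assumes A: "sigma_projective A"
    and R: "\<And>(n::nat) x x' y y'. (\<And>i. i < N n \<Longrightarrow> x i = x' i) \<Longrightarrow> (\<And>i. i < N n \<Longrightarrow> y i = y' i) \<Longrightarrow>
              R n x y \<Longrightarrow> R n x' y'"
  shows "in_hierarchy {x::nat \<Rightarrow> nat. \<exists>y. baire_to_real y \<in> A \<and> (\<forall>n. R n x y)}"
proof -
  let ?o = "\<lambda>(z::nat \<Rightarrow> nat) n. z (2 * n + 1)"
  let ?e = "\<lambda>(z::nat \<Rightarrow> nat) n. z (2 * n)"
  obtain \<xi> where \<xi>: "Sigma1 \<xi> A"
    using A by (auto simp: sigma_projective_iff in_hierarchy_def)
  have co: "continuous_on UNIV (\<lambda>z. baire_to_real (?o z))"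
    by (rule continuous_on_compose2[OF continuous_on_baire_to_real continuous_on_odds]) auto
  have "closed {z. \<forall>n. R n (?e z) (?o z)}"
    \<comment> \<open>In the interleaved sequence the first \<open>N n\<close> entries of both
      points occupy the first \<open>2 * N n\<close> places.\<close>
    by (rule closed_baire_Collect_all[where N = "\<lambda>n. 2 * N n"]) (erule R[rotated 2], auto)
  then have "in_hierarchy ((\<lambda>z. baire_to_real (?o z)) -` A \<inter> {z. \<forall>n. R n (?e z) (?o z)})"
    by (intro in_hierarchy_Int in_hierarchy_closed in_hierarchy_vimage_real[OF \<xi> co])
  then have "in_hierarchy (?e ` ((\<lambda>z. baire_to_real (?o z)) -` A \<inter> {z. \<forall>n. R n (?e z) (?o z)}))"
    by (rule in_hierarchy_evens_image)
  then show ?thesis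
    using evens_image_eq[of "\<lambda>x y. baire_to_real y \<in> A \<and> (\<forall>n. R n x y)"]
    by (simp add: vimage_def Int_def)
qed

section \<open>Runs of a game\<close>

primrec play :: "(nat list \<Rightarrow> nat) \<Rightarrow> (nat list \<Rightarrow> nat) \<Rightarrow> nat \<Rightarrow> nat list" where
  "play s t 0 = []"
| "play s t (Suc n) = play s t n @ [if even n then s (play s t n) else t (play s t n)]"

definition run :: "(nat list \<Rightarrow> nat) \<Rightarrow> (nat list \<Rightarrow> nat) \<Rightarrow> nat \<Rightarrow> nat" where
  "run s t n = (if even n then s (play s t n) else t (play s t n))"

lemma map_run: "map (run s t) [0..<n] = play s t n"
  by (induction n) (auto simp: run_def)

lemma run_even: "run s t (2 * n) = s (map (run s t) [0..<2 * n])"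
  and run_odd: "run s t (2 * n + 1) = t (map (run s t) [0..<2 * n + 1])"
  unfolding map_run by (simp_all add: run_def)

lemma length_play [simp]: "length (play s t n) = n"
  by (induction n) auto

text \<open>A player whose moves are fixed in advance. Since \<open>length h div 2\<close> is the
  current round at even and at odd positions, this serves both players.\<close>

definition oblivious :: "(nat \<Rightarrow> nat) \<Rightarrow> nat list \<Rightarrow> nat" where
  "oblivious b h = b (length h div 2)"

lemma oblivious_play: "oblivious b (play s t n) = b (n div 2)"
  by (simp add: oblivious_def)

lemma run_oblivious_even: "run (oblivious w) t (2 * n) = w n"
  and run_oblivious_odd: "run s (oblivious b) (2 * n + 1) = b n"
  unfolding run_def oblivious_play by simp_all

text \<open>Player I moves first in a round, so the entry at index \<open>2 * n\<close> still
  depends on the first \<open>n\<close> answers only. In \<open>run_oblivious_cong'\<close> the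
  fixed moves are those of player I, and agreement ends before that index.\<close>

lemma run_oblivious_cong:
  assumes "\<And>k. k < n \<Longrightarrow> b k = b' k" "i < 2 * n + 1"
  shows "run s (oblivious b) i = run s (oblivious b') i"
  using assms(2)
proof (induction i rule: less_induct)
  case (less i)
  then have "play s (oblivious b) i = play s (oblivious b') i"
    unfolding map_run[symmetric] by (intro map_cong) auto
  moreover have "odd i \<Longrightarrow> b (i div 2) = b' (i div 2)"
    using less.prems assms(1)[of "i div 2"] by presburger
  ultimately show ?case
    by (auto simp: run_def oblivious_play)
qed

lemma run_oblivious_cong':
  assumes "\<And>k. k < n \<Longrightarrow> w k = w' k" "i < 2 * n"
  shows "run (oblivious w) t i = run (oblivious w') t i"
  using assms(2)
proof (induction i rule: less_induct)
  case (less i)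
  then have "play (oblivious w) t i = play (oblivious w') t i"
    unfolding map_run[symmetric] by (intro map_cong) auto
  moreover have "w (i div 2) = w' (i div 2)"
    using less.prems assms(1)[of "i div 2"] by presburger
  ultimately show ?case
    by (auto simp: run_def oblivious_play)
qed

section \<open>Zero-one sequences with infinitely many ones\<close>

primrec ones_pos :: "(nat \<Rightarrow> nat) \<Rightarrow> nat \<Rightarrow> nat" where
  "ones_pos f 0 = f 0"
| "ones_pos f (Suc j) = Suc (ones_pos f j + f (Suc j))"

text \<open>The entries of \<open>f\<close> are the lengths of the blocks of zeros.\<close>

definition ones_seq :: "(nat \<Rightarrow> nat) \<Rightarrow> nat \<Rightarrow> nat" where
  "ones_seq f n = (if n \<in> range (ones_pos f) then 1 else 0)"

lemma strict_mono_ones_pos: "strict_mono (ones_pos f)"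
  by (auto simp: strict_mono_Suc_iff)

lemma ones_pos_cong: "(\<And>i. i \<le> j \<Longrightarrow> f i = f' i) \<Longrightarrow> ones_pos f j = ones_pos f' j"
  by (induction j) auto

text \<open>Continuity of the coding: the one number \<open>j\<close> stands at a position not below
  \<open>j\<close>, so the first \<open>n\<close> block lengths determine the first \<open>n\<close>
  entries.\<close>

lemma ones_seq_cong:
  assumes "\<And>i. i < n \<Longrightarrow> f i = f' i" "k < n"
  shows "ones_seq f k = ones_seq f' k"
proof -
  have *: "k \<in> range (ones_pos g')" if "k \<in> range (ones_pos g)" "\<And>i. i < n \<Longrightarrow> g i = g' i" for g g'
  proof -
    obtain j where j: "k = ones_pos g j" using \<open>k \<in> range (ones_pos g)\<close> by blast
    then have "j \<le> k" using strict_mono_imp_increasing[OF strict_mono_ones_pos] by blast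
    then show ?thesis using ones_pos_cong[of j g g'] that(2) assms(2) j by auto
  qed
  show ?thesis
    using *[of f f'] *[of f' f] assms(1) by (auto simp: ones_seq_def)
qed

text \<open>Continuity of the decoding. By induction the ones up to number \<open>n\<close> stand at
  the same positions, since the two sequences have the same ones in this range.\<close>

lemma ones_seq_determines:
  assumes eq: "\<And>k. k \<le> ones_pos f n \<Longrightarrow> ones_seq f k = ones_seq f' k" and "i \<le> n"
  shows "f i = f' i"
proof -
  have rng: "k \<in> range (ones_pos f) \<longleftrightarrow> k \<in> range (ones_pos f')" if "k \<le> ones_pos f n" for k
    using eq[OF that] by (auto simp: ones_seq_def split: if_splits)
  have pos: "ones_pos f j = ones_pos f' j" if "j \<le> n" for j
    using that
  proof (induction j rule: less_induct)
    case (less j)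
    have le: "ones_pos f j \<le> ones_pos f n"
      using less.prems strict_mono_less_eq[OF strict_mono_ones_pos] by blast
    obtain i where i: "ones_pos f j = ones_pos f' i"
      using rng[OF le] by blast
    \<comment> \<open>A smaller index is impossible: there the positions already agree, and
      \<open>ones_pos\<close> is injective.\<close>
    have "j \<le> i"
    proof (rule ccontr)
      assume "\<not> j \<le> i"
      then have "ones_pos f i = ones_pos f' i" using less by simp
      then show False
        using i \<open>\<not> j \<le> i\<close> strict_mono_eq[OF strict_mono_ones_pos, of f j i] by simp
    qed
    then have a: "ones_pos f' j \<le> ones_pos f j"
      unfolding i using strict_mono_less_eq[OF strict_mono_ones_pos] by blast
    obtain i' where i': "ones_pos f' j = ones_pos f i'"
      using rng[of "ones_pos f' j"] a le by auto
    have "j \<le> i'"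
    proof (rule ccontr)
      assume "\<not> j \<le> i'"
      then have "ones_pos f i' = ones_pos f' i'" using less by simp
      then show False
        using i' \<open>\<not> j \<le> i'\<close> strict_mono_eq[OF strict_mono_ones_pos, of f' j i'] by simp
    qed
    then have "ones_pos f j \<le> ones_pos f' j"
      unfolding i' using strict_mono_less_eq[OF strict_mono_ones_pos] by blast
    with a show ?case by simp
  qed
  show ?thesis
    using pos[of i] pos[of "i - 1"] assms(2) by (cases i) auto
qed

lemma ones_seq_surj:
  assumes "\<And>n. b n \<in> {0, 1}" "\<And>m. \<exists>n\<ge>m. b n \<noteq> (0::nat)"
  shows "\<exists>f. ones_seq f = b"
proof -
  define S where "S = {n. b n \<noteq> 0}"
  have inf: "infinite S"
    unfolding S_def infinite_nat_iff_unbounded_le using assms(2) by auto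
  define f where "f = (\<lambda>j. case j of 0 \<Rightarrow> enumerate S 0
     | Suc j \<Rightarrow> enumerate S (Suc j) - Suc (enumerate S j))"
  have "ones_pos f j = enumerate S j" for j
  proof (induction j)
    case (Suc j)
    then show ?case using enumerate_step[OF inf, of j] by (simp add: f_def)
  qed (simp add: f_def)
  then have "range (ones_pos f) = S"
    using range_enumerate[OF inf] by (metis image_cong)
  then have "ones_seq f n = b n" for n
    using assms(1)[of n] by (auto simp: ones_seq_def S_def)
  then show ?thesis by blast
qed

lemma ones_seq_infinite: "\<exists>n\<ge>m. ones_seq f n \<noteq> 0"
  using strict_mono_imp_increasing[OF strict_mono_ones_pos, of m f]
  by (intro exI[of _ "ones_pos f m"]) (auto simp: ones_seq_def)

lemma ones_seq_01: "ones_seq f n \<in> {0, 1}"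
  by (auto simp: ones_seq_def)

section \<open>The game\<close>

lemma compactin_decreasing_Int:
  assumes "compactin X K" "\<And>n::nat. closedin X (E n)" "\<And>n. E (Suc n) \<subseteq> E n"
    and ne: "\<And>n. K \<inter> E n \<noteq> {}"
  shows "K \<inter> (\<Inter>n. E n) \<noteq> {}"
proof -
  have mono: "E n \<subseteq> E m" if "m \<le> n" for m n
    using lift_Suc_antimono_le[of E, OF assms(3) that] by simp
  have "K \<inter> \<Inter>(range E) \<noteq> {}"
  proof (rule assms(1)[unfolded compactin_fip, THEN conjunct2, rule_format, of "range E"], safe)
    fix \<F> assume \<F>: "finite \<F>" "\<F> \<subseteq> range E" "K \<inter> \<Inter>\<F> = {}"
    then obtain J where J: "finite J" "\<F> = E ` J"
      by (meson finite_subset_image)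
    obtain m where "\<And>j. j \<in> J \<Longrightarrow> j \<le> m"
      using J(1) finite_nat_set_iff_bounded_le by auto
    then have "E m \<subseteq> \<Inter>\<F>" using J mono by blast
    then show False using \<F>(3) ne[of m] by blast
  qed (use assms(2) in auto)
  then show ?thesis by simp
qed

definition extends :: "nat list \<Rightarrow> (nat \<Rightarrow> nat) \<Rightarrow> bool" where
  "extends t y \<longleftrightarrow> (\<forall>i<length t. y i = t ! i)"

lemma extends_Nil [simp]: "extends [] y"
  by (simp add: extends_def)

lemma extends_snoc: "extends (t @ [k]) y \<longleftrightarrow> extends t y \<and> y (length t) = k"
  by (auto simp: extends_def nth_append less_Suc_eq)

text \<open>Closedness of the values is listed separately because compact sets need not be closed in
  \<open>X\<close>. The definability of \<open>Y\<close> is expressed by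
  \<open>projection\<close>.\<close>

locale usc_cover =
  fixes X :: "'a topology" and Y :: "(nat \<Rightarrow> nat) set" and F :: "(nat \<Rightarrow> nat) \<Rightarrow> 'a set"
  assumes compact_F: "y \<in> Y \<Longrightarrow> compactin X (F y)"
    and closed_F: "y \<in> Y \<Longrightarrow> closedin X (F y)"
    and usc_F: "y \<in> Y \<Longrightarrow> closedin X C \<Longrightarrow> F y \<inter> C = {} \<Longrightarrow>
          \<exists>n. \<forall>y'\<in>Y. (\<forall>i<n. y' i = y i) \<longrightarrow> F y' \<inter> C = {}"
    and cover_F: "(\<Union>y\<in>Y. F y) = topspace X"
    and projection: "\<And>(R :: nat \<Rightarrow> (nat \<Rightarrow> nat) \<Rightarrow> (nat \<Rightarrow> nat) \<Rightarrow> bool) N.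
          (\<And>n x x' y y'. (\<And>i. i < N n \<Longrightarrow> x i = x' i) \<Longrightarrow> (\<And>i. i < N n \<Longrightarrow> y i = y' i) \<Longrightarrow>
              R n x y \<Longrightarrow> R n x' y') \<Longrightarrow>
          in_hierarchy {x. \<exists>y\<in>Y. \<forall>n. R n x y}"
    and regular: "regular_space X"

locale hurewicz_game = usc_cover +
  fixes W :: "nat \<Rightarrow> 'a set"
  assumes closed_W: "closedin X (W n)"
begin

text \<open>A move of player I codes a triple: a container \<open>W c\<close> for the moves after a refusal, a
  closed set \<open>W v\<close> to be entered after an acceptance, and one more digit of the point of \<open>Y\<close> that
  player I is constructing. A nonzero move of player II is an acceptance.\<close>

definition mc :: "nat \<Rightarrow> nat" where "mc u = fst (prod_decode u)"
definition mv :: "nat \<Rightarrow> nat" where "mv u = fst (prod_decode (snd (prod_decode u)))"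
definition mk :: "nat \<Rightarrow> nat" where "mk u = snd (prod_decode (snd (prod_decode u)))"

lemma ex_move: "\<exists>u. mc u = c \<and> mv u = v \<and> mk u = k"
  by (rule exI[of _ "prod_encode (c, prod_encode (v, k))"]) (simp add: mc_def mv_def mk_def)

primrec state :: "(nat \<Rightarrow> nat) \<Rightarrow> nat \<Rightarrow> nat list \<times> 'a set" where
  "state x 0 = ([], topspace X)"
| "state x (Suc n) =
     (if x (2 * n + 1) \<noteq> 0 then (fst (state x n) @ [mk (x (2 * n))], W (mv (x (2 * n))))
      else (fst (state x n), W (mc (x (2 * n)))))"

abbreviation "stem x n \<equiv> fst (state x n)"
abbreviation "cell x n \<equiv> snd (state x n)"

text \<open>The last clause ties the set offered for acceptance to the digits played; it later makes
  the limit sets nonempty.\<close>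

definition legal :: "(nat \<Rightarrow> nat) \<Rightarrow> nat \<Rightarrow> bool" where
  "legal x n \<longleftrightarrow> W (mv (x (2 * n))) \<subseteq> cell x n \<and> W (mc (x (2 * n))) \<subseteq> cell x n \<and>
     W (mv (x (2 * n))) \<inter> W (mc (x (2 * n))) = {} \<and>
     (\<exists>y\<in>Y. extends (stem x n @ [mk (x (2 * n))]) y \<and> F y \<inter> W (mv (x (2 * n))) \<noteq> {})"

definition payoff :: "(nat \<Rightarrow> nat) set" where
  "payoff = {x. (\<forall>n. legal x n) \<and>
     (if \<forall>m. \<exists>n\<ge>m. x (2 * n + 1) \<noteq> 0 then \<exists>y\<in>Y. \<forall>n. extends (stem x n) y
      else \<not> (\<exists>y\<in>Y. \<forall>n. F y \<inter> cell x n \<noteq> {}))}"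

section \<open>Locality and complexity of the payoff set\<close>

lemma state_cong: "(\<And>i. i < 2 * n \<Longrightarrow> x i = x' i) \<Longrightarrow> state x n = state x' n"
  by (induction n) auto

lemma legal_cong: "(\<And>i. i < 2 * n + 1 \<Longrightarrow> x i = x' i) \<Longrightarrow> legal x n = legal x' n"
  using state_cong[of n x x'] by (simp add: legal_def)

lemma length_stem: "length (stem x n) \<le> n"
  by (induction n) (auto split: if_splits)

lemma closedin_cell: "closedin X (cell x n)"
  by (cases n) (auto simp: closed_W)

lemma cell_Suc: "legal x n \<Longrightarrow> cell x (Suc n) \<subseteq> cell x n"
  by (auto simp: legal_def)

text \<open>Legality and infinitely many acceptances are countable combinations of conditions on
  finite prefixes. The two quantifiers over \<open>Y\<close> are handled by
  \<open>projection\<close>, the second one under a complement.\<close>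

lemma payoff_in_hierarchy: "in_hierarchy payoff"
proof -
  define L where "L = {x. \<forall>n. legal x n}"
  define I where "I = (\<Inter>m. {x::nat \<Rightarrow> nat. \<exists>n\<ge>m. x (2 * n + 1) \<noteq> 0})"
  define P where "P = {x. \<exists>y\<in>Y. \<forall>n. extends (stem x n) y}"
  \<comment> \<open>Whether \<open>F y\<close> meets a cell is not decided by finitely many entries
    of \<open>y\<close>. Here \<open>y\<close> is replaced at stage \<open>n\<close> by some
    \<open>y'\<close> that agrees with it that far.\<close>
  define Q where "Q = {x. \<exists>y\<in>Y. \<forall>n. \<exists>y'\<in>Y. (\<forall>i<n. y' i = y i) \<and> F y' \<inter> cell x n \<noteq> {}}"
  have L: "in_hierarchy L"
    unfolding L_def
    by (intro in_hierarchy_closed closed_baire_Collect_all[where N = "\<lambda>n. 2 * n + 1"])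
      (use legal_cong in blast)
  have I: "in_hierarchy I"
    unfolding I_def
  proof (rule in_hierarchy_INT_nat)
    fix m
    have "closed {x::nat \<Rightarrow> nat. \<forall>n. n \<ge> m \<longrightarrow> x (2 * n + 1) = 0}"
      by (rule closed_baire_Collect_all[where N = "\<lambda>n. 2 * n + 2"]) auto
    then have "in_hierarchy (- {x::nat \<Rightarrow> nat. \<forall>n. n \<ge> m \<longrightarrow> x (2 * n + 1) = 0})"
      by (intro in_hierarchy_Compl in_hierarchy_closed)
    moreover have "- {x::nat \<Rightarrow> nat. \<forall>n. n \<ge> m \<longrightarrow> x (2 * n + 1) = 0} = {x. \<exists>n\<ge>m. x (2 * n + 1) \<noteq> 0}"
      by auto
    ultimately show "in_hierarchy {x::nat \<Rightarrow> nat. \<exists>n\<ge>m. x (2 * n + 1) \<noteq> 0}" by simp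
  qed
  have P: "in_hierarchy P"
    unfolding P_def
  proof (rule projection[where N = "\<lambda>n. 2 * n"])
    fix n and x x' y y' :: "nat \<Rightarrow> nat"
    assume x: "\<And>i. i < 2 * n \<Longrightarrow> x i = x' i" and y: "\<And>i. i < 2 * n \<Longrightarrow> y i = y' i"
      and e: "extends (stem x n) y"
    then have "stem x' n = stem x n" using state_cong by metis
    moreover have "y i = y' i" if "i < length (stem x n)" for i
      using y that length_stem[of x n] by simp
    ultimately show "extends (stem x' n) y'"
      using e by (simp add: extends_def)
  qed
  have Q: "in_hierarchy Q"
    unfolding Q_def
  proof (rule projection[where N = "\<lambda>n. 2 * n"])
    fix n and x x' y y' :: "nat \<Rightarrow> nat"
    assume x: "\<And>i. i < 2 * n \<Longrightarrow> x i = x' i" and y: "\<And>i. i < 2 * n \<Longrightarrow> y i = y' i"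
      and e: "\<exists>z\<in>Y. (\<forall>i<n. z i = y i) \<and> F z \<inter> cell x n \<noteq> {}"
    have "cell x' n = cell x n" using state_cong[OF x] by simp
    then show "\<exists>z\<in>Y. (\<forall>i<n. z i = y' i) \<and> F z \<inter> cell x' n \<noteq> {}"
      using e y by auto
  qed
  have Q_iff: "x \<in> Q \<longleftrightarrow> (\<exists>y\<in>Y. \<forall>n. F y \<inter> cell x n \<noteq> {})" if "x \<in> L" for x
  proof
    assume "x \<in> Q"
    then obtain y where y: "y \<in> Y" "\<And>n. \<exists>y'\<in>Y. (\<forall>i<n. y' i = y i) \<and> F y' \<inter> cell x n \<noteq> {}"
      by (auto simp: Q_def)
    have dec: "cell x (Suc n) \<subseteq> cell x n" for n
      using cell_Suc \<open>x \<in> L\<close> by (simp only: L_def mem_Collect_eq)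
    have mono: "cell x n \<subseteq> cell x m" if "m \<le> n" for m n
      using lift_Suc_antimono_le[of "cell x", OF dec that] .
    \<comment> \<open>If \<open>F y\<close> missed a cell, the values at all close approximations
      would miss it, and with it all later, smaller cells.\<close>
    have "F y \<inter> cell x m \<noteq> {}" for m
    proof
      assume "F y \<inter> cell x m = {}"
      from usc_F[OF y(1) closedin_cell this]
      obtain n where n: "\<forall>y'\<in>Y. (\<forall>i<n. y' i = y i) \<longrightarrow> F y' \<inter> cell x m = {}" ..
      from y(2)[of "max m n"] obtain y'
        where y': "y' \<in> Y" "\<forall>i<max m n. y' i = y i" "F y' \<inter> cell x (max m n) \<noteq> {}" by blast
      have "F y' \<inter> cell x m = {}" using n y'(1,2) by simp
      then show False
        using y'(3) mono[of m "max m n", OF max.cobounded1] by blast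
    qed
    then show "\<exists>y\<in>Y. \<forall>n. F y \<inter> cell x n \<noteq> {}" using y(1) by blast
  next
    assume "\<exists>y\<in>Y. \<forall>n. F y \<inter> cell x n \<noteq> {}"
    then obtain y where y: "y \<in> Y" "\<forall>n. F y \<inter> cell x n \<noteq> {}" by blast
    then have "\<forall>n. \<exists>y'\<in>Y. (\<forall>i<n. y' i = y i) \<and> F y' \<inter> cell x n \<noteq> {}"
      by (intro allI bexI[of _ y]) auto
    then show "x \<in> Q" unfolding Q_def using y(1) by blast
  qed
  have "payoff = L \<inter> ((I \<inter> P) \<union> (- I \<inter> - Q))"
  proof (rule set_eqI)
    fix x
    have i: "(\<forall>m. \<exists>n\<ge>m. x (2 * n + 1) \<noteq> 0) \<longleftrightarrow> x \<in> I"
      by (simp add: I_def)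
    show "x \<in> payoff \<longleftrightarrow> x \<in> L \<inter> ((I \<inter> P) \<union> (- I \<inter> - Q))"
    proof (cases "x \<in> L")
      case True
      then show ?thesis
        unfolding payoff_def mem_Collect_eq i using Q_iff[OF True] by (auto simp: L_def P_def)
    next
      case False
      then show ?thesis by (auto simp: payoff_def L_def)
    qed
  qed
  then show ?thesis
    by (simp add: L I P Q in_hierarchy_Int in_hierarchy_Un in_hierarchy_Compl)
qed

section \<open>Winning strategies of player I\<close>

text \<open>Against any answers with infinitely many acceptances the strategy yields a point of
  \<open>Y\<close> and a nonempty compact part of its value. These parts are disjoint and depend
  upper semicontinuously on the answers; sending each to its code is a perfect map on their
  union.\<close>

lemma player_I_wins_imp_perfect_preimage:
  assumes win: "winning_I payoff s"
  shows "\<exists>C h. closedin X C \<and> perfect_map (subtopology X C) (euclidean :: (nat \<Rightarrow> nat) topology) h"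
proof -
  \<comment> \<open>Player II's answers are prescribed by \<open>b\<close>. Below, \<open>T\<close>
    and \<open>D\<close> are the resulting stems and cells, \<open>V\<close> and \<open>E\<close>
    the two options offered in a round.\<close>
  define xr where "xr = (\<lambda>b. run s (oblivious b))"
  define T where "T = (\<lambda>b n. stem (xr b) n)"
  define D where "D = (\<lambda>b n. cell (xr b) n)"
  define V where "V = (\<lambda>b n. W (mv (xr b (2 * n))))"
  define E where "E = (\<lambda>b n. W (mc (xr b (2 * n))))"
  have pay: "xr b \<in> payoff" for b
    using win run_even unfolding winning_I_def xr_def by blast
  have leg: "legal (xr b) n" for b n
    using pay[of b] by (simp add: payoff_def)
  have odd: "xr b (2 * n + 1) = b n" for b n
    unfolding xr_def by (rule run_oblivious_odd)
  have agree: "xr b i = xr b' i" if "\<And>k. k < n \<Longrightarrow> b k = b' k" "i < 2 * n + 1" for b b' n i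
    unfolding xr_def by (rule run_oblivious_cong[OF that])
  have T_cong: "T b n = T b' n" and D_cong: "D b n = D b' n"
    if "\<And>k. k < n \<Longrightarrow> b k = b' k" for b b' n
    using state_cong[of n "xr b" "xr b'"] agree[of n b b', OF that] by (simp_all add: T_def D_def)
  have VE_cong: "V b n = V b' n" "E b n = E b' n" if "\<And>k. k < n \<Longrightarrow> b k = b' k" for b b' n
    using agree[of n b b' "2 * n", OF that] by (simp_all add: V_def E_def)
  have D_Suc: "D b (Suc n) = (if b n \<noteq> 0 then V b n else E b n)" for b n
    using odd[of b n] by (simp add: D_def V_def E_def)
  have T_Suc: "length (T b (Suc n)) = (if b n \<noteq> 0 then Suc (length (T b n)) else length (T b n))" for b n
    using odd[of b n] by (simp add: T_def)
  have disj: "V b n \<inter> E b n = {}" and V_sub: "V b n \<subseteq> D b n" for b n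
    using leg[of b n] by (auto simp: legal_def V_def E_def D_def)
  have D_closed: "closedin X (D b n)" for b n
    by (simp add: D_def closedin_cell)
  have D_dec: "D b (Suc n) \<subseteq> D b n" for b n
    unfolding D_def by (rule cell_Suc[OF leg])
  have D_anti: "D b n \<subseteq> D b m" if "m \<le> n" for b m n
    using lift_Suc_antimono_le[of "D b", OF D_dec that] .
  have T_mono: "length (T b m) \<le> length (T b n)" if "m \<le> n" for b m n
    by (rule lift_Suc_mono_le[of "\<lambda>n. length (T b n)", OF _ that]) (simp add: T_Suc)
  have T_unb: "\<exists>n. m \<le> length (T (ones_seq f) n)" for m f
  proof (induction m)
    case (Suc m)
    then obtain n where n: "m \<le> length (T (ones_seq f) n)" by blast
    obtain k where k: "k \<ge> n" "ones_seq f k \<noteq> 0" using ones_seq_infinite by blast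
    have "Suc m \<le> length (T (ones_seq f) (Suc k))"
      using n k(2) T_mono[OF k(1), of "ones_seq f"] by (simp add: T_Suc)
    then show ?case ..
  qed simp
  have T_unb2: "\<exists>n\<ge>k. m \<le> length (T (ones_seq f) n)" for m k f
  proof -
    obtain n where n: "m \<le> length (T (ones_seq f) n)" using T_unb by blast
    then show ?thesis
      using T_mono[of n "max k n" "ones_seq f"] by (intro exI[of _ "max k n"]) simp
  qed
  have "\<exists>y\<in>Y. \<forall>n. extends (T (ones_seq f) n) y" for f
  proof -
    have "\<forall>m. \<exists>n\<ge>m. xr (ones_seq f) (2 * n + 1) \<noteq> 0"
      unfolding odd using ones_seq_infinite by blast
    then show ?thesis
      using pay[of "ones_seq f"] by (simp add: payoff_def T_def)
  qed
  then obtain a where a: "\<And>f. a f \<in> Y" "\<And>f n. extends (T (ones_seq f) n) (a f)"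
    by metis
  have a_agree: "a f' i = a f i"
    if "i < length (T (ones_seq f) n)" "\<And>k. k < n \<Longrightarrow> ones_seq f k = ones_seq f' k" for f f' n i
    using a(2)[of f n] a(2)[of f' n] T_cong[OF that(2)] that(1) by (simp add: extends_def)
  \<comment> \<open>In some round \<open>j\<close> after \<open>n\<close> the stem is long enough to
    control \<open>F\<close> near \<open>a f\<close>. Legality of that round provides a value
    meeting a subset of the cell numbered \<open>n\<close>.\<close>
  have meet: "F (a f) \<inter> D (ones_seq f) n \<noteq> {}" for f n
  proof
    assume "F (a f) \<inter> D (ones_seq f) n = {}"
    from usc_F[OF a(1) D_closed this]
    obtain m where m: "\<forall>y'\<in>Y. (\<forall>i<m. y' i = a f i) \<longrightarrow> F y' \<inter> D (ones_seq f) n = {}" ..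
    obtain j where j: "j \<ge> n" "m \<le> length (T (ones_seq f) j)" using T_unb2 by blast
    obtain y k where y: "y \<in> Y" "extends (T (ones_seq f) j @ [k]) y" "F y \<inter> V (ones_seq f) j \<noteq> {}"
      using leg[of "ones_seq f" j] by (auto simp: legal_def T_def V_def)
    have "\<forall>i<m. y i = a f i"
      using y(2) a(2)[of f j] j(2) unfolding extends_snoc by (simp add: extends_def)
    then have "F y \<inter> D (ones_seq f) n = {}" using m y(1) by blast
    then show False using y(3) V_sub[of "ones_seq f" j] D_anti[OF j(1)] by blast
  qed
  define K where "K = (\<lambda>f. F (a f) \<inter> (\<Inter>n. D (ones_seq f) n))"
  have K_ne: "K f \<noteq> {}" for f
    unfolding K_def
    by (rule compactin_decreasing_Int) (rule compact_F[OF a(1)] D_closed D_dec meet)+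
  have K_closed: "closedin X (K f)" for f
    unfolding K_def by (intro closedin_Int closedin_INT closed_F a) (auto simp: D_closed)
  have K_compact: "compactin X (K f)" for f
    using closed_compactin[OF compact_F[OF a(1)] _ K_closed] unfolding K_def by blast
  \<comment> \<open>At the first difference one sequence accepts and the other refuses, and the two
    options are disjoint.\<close>
  have step: "b k = b' k"
    if "z \<in> D b (Suc k)" "z \<in> D b' (Suc k)" "\<And>i. i < k \<Longrightarrow> b i = b' i" "b k \<in> {0,1}" "b' k \<in> {0,1}"
    for z b b' k
  proof (rule ccontr)
    assume ne: "b k \<noteq> b' k"
    have "V b k \<inter> E b k = {}" "V b' k = V b k" "E b' k = E b k"
      using disj VE_cong[of k b b', OF that(3)] by simp_all
    then show False
      using that(1,2,4,5) ne unfolding D_Suc by (auto split: if_splits)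
  qed
  have K_inj: "f = f'" if "z \<in> K f" "z \<in> K f'" for z f f'
  proof -
    have zD: "z \<in> D (ones_seq f) n" "z \<in> D (ones_seq f') n" for n
      using that by (auto simp: K_def)
    have "ones_seq f k = ones_seq f' k" for k
    proof (induction k rule: less_induct)
      case (less k)
      show ?case
        by (rule step[OF zD(1) zD(2)]) (use less ones_seq_01 in blast)+
    qed
    then show ?thesis using ones_seq_determines[of f _ f'] by blast
  qed
  define C where "C = (\<Union>f. K f)"
  have C_top: "C \<subseteq> topspace X"
    unfolding C_def using K_closed closedin_subset by blast
  define P where "P = (\<lambda>l. {u. \<exists>f. u \<in> K f \<and> extends l (ones_seq f)})"
  have "X closure_of C \<subseteq> C"
  proof
    fix z assume z: "z \<in> X closure_of C"
    \<comment> \<open>Splitting by the next bit of the code leaves \<open>z\<close> in the closure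
      of one of the halves. Iterating this produces a candidate code \<open>b\<close> for
      \<open>z\<close>.\<close>
    have "\<exists>e. e \<in> {0,1} \<and> z \<in> X closure_of P (l @ [e])" if "z \<in> X closure_of P l" for l
    proof -
      have "P l \<subseteq> P (l @ [0]) \<union> P (l @ [1])"
        unfolding P_def extends_snoc using ones_seq_01 by fastforce
      then have "z \<in> X closure_of (P (l @ [0]) \<union> P (l @ [1]))"
        using that closure_of_mono by blast
      then show ?thesis by (auto simp: closure_of_Un)
    qed
    then obtain e where e: "\<And>l. z \<in> X closure_of P l \<Longrightarrow> e l \<in> {0,1} \<and> z \<in> X closure_of P (l @ [e l])"
      by metis
    define L where "L = rec_nat [] (\<lambda>_ l. l @ [e l])"
    define b where "b = (\<lambda>n. e (L n))"
    have L: "L n = map b [0..<n]" for n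
      by (induction n) (simp_all add: L_def b_def)
    have "P [] = C" by (auto simp: P_def C_def)
    then have zL: "z \<in> X closure_of P (L n)" for n
      by (induction n) (use z e in \<open>simp_all add: L_def\<close>)
    have b01: "b n \<in> {0,1}" for n
      using e[OF zL] by (simp add: b_def)
    have PL: "\<exists>f. u \<in> K f \<and> (\<forall>k<n. ones_seq f k = b k)" if "u \<in> P (L n)" for u n
      using that unfolding P_def L extends_def by auto
    have zD: "z \<in> D b n" for n
    proof -
      have "P (L n) \<subseteq> D b n"
      proof
        fix u assume "u \<in> P (L n)"
        then obtain f where f: "u \<in> K f" "\<forall>k<n. ones_seq f k = b k" using PL by blast
        then show "u \<in> D b n" using D_cong[of n "ones_seq f" b] by (auto simp: K_def)
      qed
      then show ?thesis
        using zL[of n] closure_of_minimal[OF _ D_closed] by blast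
    qed
    have ztop: "z \<in> topspace X" using z in_closure_of by metis
    \<comment> \<open>With refusals only from some round on, the payoff would forbid a value meeting
      all cells; but \<open>z\<close> lies in all cells and in some value.\<close>
    have "\<forall>m. \<exists>n\<ge>m. b n \<noteq> 0"
    proof (rule ccontr)
      assume "\<not> ?thesis"
      then have "\<not> (\<forall>m. \<exists>n\<ge>m. xr b (2 * n + 1) \<noteq> 0)" unfolding odd .
      then have "\<not> (\<exists>y\<in>Y. \<forall>n. F y \<inter> D b n \<noteq> {})"
        using pay[of b] unfolding payoff_def D_def by (simp only: mem_Collect_eq if_False simp_thms)
      moreover obtain y where "y \<in> Y" "z \<in> F y" using ztop cover_F by blast
      ultimately show False using zD by blast
    qed
    then obtain f where f: "ones_seq f = b"
      using ones_seq_surj[of b] b01 by blast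
    \<comment> \<open>Otherwise regularity gives a neighbourhood of \<open>z\<close> that is avoided
      by the values for all codes close to \<open>f\<close>, although points with such codes
      accumulate at \<open>z\<close>.\<close>
    have "z \<in> F (a f)"
    proof (rule ccontr)
      assume "z \<notin> F (a f)"
      then obtain U O' where U: "openin X U" "openin X O'" "z \<in> U" "F (a f) \<subseteq> O'" "disjnt U O'"
        using regular closed_F[OF a(1)] ztop unfolding regular_space_def by (metis DiffI)
      define G where "G = topspace X - O'"
      have "closedin X G" "F (a f) \<inter> G = {}" using U by (auto simp: G_def)
      from usc_F[OF a(1) this]
      obtain m where m: "\<forall>y'\<in>Y. (\<forall>i<m. y' i = a f i) \<longrightarrow> F y' \<inter> G = {}" ..
      obtain n where n: "m \<le> length (T (ones_seq f) n)" using T_unb by blast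
      obtain u where u: "u \<in> P (L n)" "u \<in> U"
        using zL[of n] U(1,3) unfolding in_closure_of by blast
      then obtain f' where f': "u \<in> K f'" "\<forall>k<n. ones_seq f' k = b k" using PL by blast
      have "\<forall>i<m. a f' i = a f i"
        using a_agree[of _ f n f'] n f' f by simp
      then have "F (a f') \<inter> G = {}" using m a(1) by blast
      moreover have "u \<in> F (a f')" "u \<in> topspace X"
        using f' C_top by (auto simp: K_def C_def)
      ultimately show False using u(2) U(5) by (auto simp: G_def disjnt_iff)
    qed
    then have "z \<in> K f" using zD f by (simp add: K_def)
    then show "z \<in> C" by (auto simp: C_def)
  qed
  then have C_closed: "closedin X C"
    using C_top closure_of_subset_eq by blast
  have K_usc: "\<exists>n. \<forall>f'. (\<forall>i<n. f' i = f i) \<longrightarrow> K f' \<inter> G = {}" if "closedin X G" "K f \<inter> G = {}" for f G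
  proof -
    \<comment> \<open>By compactness a single cell suffices in place of the whole intersection;
      semicontinuity then applies to it, and close codes share that cell.\<close>
    have "\<exists>m. F (a f) \<inter> (D (ones_seq f) m \<inter> G) = {}"
    proof (rule ccontr)
      assume "\<not> ?thesis"
      then have "F (a f) \<inter> (\<Inter>n. D (ones_seq f) n \<inter> G) \<noteq> {}"
        by (intro compactin_decreasing_Int[OF compact_F[OF a(1)]] closedin_Int D_closed that(1))
          (use D_dec in blast)+
      then show False using that(2) by (auto simp: K_def)
    qed
    then obtain m where "F (a f) \<inter> (D (ones_seq f) m \<inter> G) = {}" ..
    from usc_F[OF a(1) closedin_Int[OF D_closed that(1)] this]
    obtain j where j: "\<forall>y'\<in>Y. (\<forall>i<j. y' i = a f i) \<longrightarrow> F y' \<inter> (D (ones_seq f) m \<inter> G) = {}" ..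
    obtain n where n: "n \<ge> m" "j \<le> length (T (ones_seq f) n)" using T_unb2 by blast
    have "K f' \<inter> G = {}" if f': "\<forall>i<n. f' i = f i" for f'
    proof -
      have o: "ones_seq f k = ones_seq f' k" if "k < n" for k
        by (rule ones_seq_cong[OF _ that]) (use f' in simp)
      have "\<forall>i<j. a f' i = a f i"
        using a_agree[of _ f n f'] o n(2) by simp
      then have "F (a f') \<inter> (D (ones_seq f) m \<inter> G) = {}" using j a(1) by blast
      moreover have "D (ones_seq f) m = D (ones_seq f') m"
        using o n(1) by (intro D_cong) simp
      ultimately show ?thesis by (auto simp: K_def)
    qed
    then show ?thesis by blast
  qed
  define h where "h = (\<lambda>z. THE f. z \<in> K f)"
  have h: "h z = f" if "z \<in> K f" for z f
    unfolding h_def using that K_inj by blast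
  have hK: "z \<in> K (h z)" if "z \<in> C" for z
    using that h by (auto simp: C_def)
  have loc: "\<exists>U. openin X U \<and> z \<in> U \<and> (\<forall>z'\<in>U \<inter> C. \<forall>k<n. ones_seq (h z') k = ones_seq (h z) k)"
    if z: "z \<in> C" for z n
  proof (induction n)
    case 0
    show ?case using z C_top by (intro exI[of _ "topspace X"]) auto
  next
    case (Suc n)
    then obtain U where U: "openin X U" "z \<in> U"
      "\<forall>z'\<in>U \<inter> C. \<forall>k<n. ones_seq (h z') k = ones_seq (h z) k" by blast
    let ?b = "ones_seq (h z)"
    \<comment> \<open>\<open>G\<close> is the option that \<open>z\<close> does not enter in round
      \<open>n\<close>. Removing this closed set fixes bit \<open>n\<close> of the codes of nearby
      points.\<close>
    define G where "G = (if ?b n \<noteq> 0 then E ?b n else V ?b n)"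
    have G: "closedin X G" by (simp add: G_def E_def V_def closed_W)
    have zD: "z \<in> D ?b (Suc n)" using hK[OF z] by (simp only: K_def) blast
    then have "z \<notin> G"
      using disj[of ?b n] unfolding D_Suc G_def by (auto split: if_splits)
    have "ones_seq (h z') k = ?b k" if z': "z' \<in> (U - G) \<inter> C" and k: "k < Suc n" for z' k
    proof -
      have lt: "ones_seq (h z') i = ?b i" if "i < n" for i
        using U(3) z' that by blast
      have "z' \<in> D (ones_seq (h z')) (Suc n)" using hK[of z'] z' by (simp only: K_def) blast
      then have "ones_seq (h z') n = ?b n"
        using z' VE_cong[of n "ones_seq (h z')" ?b, OF lt] ones_seq_01[of "h z'" n] ones_seq_01[of "h z" n]
        unfolding D_Suc G_def by (auto split: if_splits)
      then show ?thesis using lt k by (metis less_Suc_eq)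
    qed
    then show ?case
      using U(1,2) G \<open>z \<notin> G\<close> by (intro exI[of _ "U - G"]) (simp add: openin_diff)
  qed
  have topC: "topspace (subtopology X C) = C"
    using C_top by auto
  have "continuous_map (subtopology X C) euclidean h"
    unfolding continuous_map topC
  proof (intro conjI allI impI)
    fix U :: "(nat \<Rightarrow> nat) set" assume "openin euclidean U"
    then have "open U" by simp
    show "openin (subtopology X C) {x \<in> C. h x \<in> U}"
    proof (subst openin_subopen, safe)
      fix z assume z: "z \<in> C" "h z \<in> U"
      then obtain n where n: "\<And>y. (\<forall>i<n. y i = h z i) \<Longrightarrow> y \<in> U"
        using \<open>open U\<close> unfolding open_baire_iff by blast
      obtain O' where O': "openin X O'" "z \<in> O'"
        "\<forall>z'\<in>O' \<inter> C. \<forall>k<Suc (ones_pos (h z) n). ones_seq (h z') k = ones_seq (h z) k"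
        using loc[OF z(1)] by blast
      have "h z' \<in> U" if "z' \<in> O' \<inter> C" for z'
      proof (rule n, intro allI impI)
        fix i assume "i < n"
        have "ones_seq (h z) k = ones_seq (h z') k" if "k \<le> ones_pos (h z) n" for k
          using O'(3) \<open>z' \<in> O' \<inter> C\<close> that by (metis less_Suc_eq_le)
        then show "h z' i = h z i"
          using ones_seq_determines[of "h z" n "h z'" i] \<open>i < n\<close> by simp
      qed
      then show "\<exists>T. openin (subtopology X C) T \<and> z \<in> T \<and> T \<subseteq> {x \<in> C. h x \<in> U}"
        using O'(1,2) z(1)
        by (intro exI[of _ "O' \<inter> C"]) (auto simp: openin_subtopology)
    qed
  qed auto
  moreover have "closed_map (subtopology X C) euclidean h"
    unfolding closed_map_def
  proof (intro allI impI)
    fix G assume "closedin (subtopology X C) G"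
    then have G: "closedin X G" "G \<subseteq> C"
      using C_closed closedin_closed_subtopology by blast+
    have "open (- (h ` G))"
      unfolding open_baire_iff
    proof
      fix f assume f: "f \<in> - (h ` G)"
      have "K f \<inter> G = {}" using f h by force
      from K_usc[OF G(1) this]
      obtain n where n: "\<forall>f'. (\<forall>i<n. f' i = f i) \<longrightarrow> K f' \<inter> G = {}" ..
      have "f' \<in> - (h ` G)" if "\<forall>i<n. f' i = f i" for f'
      proof
        assume "f' \<in> h ` G"
        then obtain z where "z \<in> G" "f' = h z" by blast
        then show False using n that hK[of z] G(2) by blast
      qed
      then show "\<exists>n. \<forall>y. (\<forall>i<n. y i = f i) \<longrightarrow> y \<in> - (h ` G)" by blast
    qed
    then show "closedin euclidean (h ` G)" by (simp add: closed_def)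
  qed
  moreover have "compactin (subtopology X C) {z \<in> topspace (subtopology X C). h z = f}" for f
  proof -
    have "{z \<in> topspace (subtopology X C). h z = f} = K f"
      unfolding topC using h hK by (auto simp: C_def)
    then show ?thesis
      using K_compact by (simp add: compactin_subtopology C_def UN_upper)
  qed
  moreover have "h ` topspace (subtopology X C) = topspace euclidean"
  proof -
    have "f \<in> h ` C" for f
      using K_ne[of f] h C_def by (metis UN_I UNIV_I ex_in_conv imageI)
    then show ?thesis unfolding topC by auto
  qed
  ultimately have "perfect_map (subtopology X C) euclidean h"
    by (simp add: perfect_map_def proper_map_def)
  then show ?thesis using C_closed by blast
qed

section \<open>Winning strategies of player II\<close>

lemma extends_stem_antimono: "n \<le> m \<Longrightarrow> extends (stem x m) y \<Longrightarrow> extends (stem x n) y"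
proof (induction m)
  case (Suc m)
  show ?case
  proof (cases "n = Suc m")
    case False
    moreover have "extends (stem x m) y"
      using Suc.prems(2) by (auto simp: extends_snoc split: if_splits)
    ultimately show ?thesis using Suc by simp
  qed (use Suc.prems in simp)
qed simp

lemma cell_in_range: "topspace X \<in> range W \<Longrightarrow> \<exists>d. W d = cell x n"
  by (cases n) auto

text \<open>These data let player I survive refusals for ever: \<open>W (v n)\<close> is offered for
  acceptance, \<open>W (c n)\<close> is what remains after a refusal, and nothing remains in the
  end.\<close>

definition escaping :: "'a set \<Rightarrow> bool" where
  "escaping E \<longleftrightarrow> (\<exists>c v z. (\<forall>n::nat. z n \<in> E \<and> z n \<in> W (v n) \<and> W (v n) \<inter> W (c n) = {} \<and>
      W (v (Suc n)) \<subseteq> W (c n) \<and> W (c (Suc n)) \<subseteq> W (c n)) \<and> (\<Inter>n. W (c n)) = {})"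

text \<open>For a point of a value \<open>F a\<close>, some compatible position has no compatible
  prolongation ending in an acceptance; otherwise player I could win by infinitely many acceptances
  along \<open>a\<close>. There are countably many positions. If the points stuck at one of them
  escaped, player I would win by being refused for ever.\<close>

lemma player_II_wins_imp_cover:
  assumes win: "winning_II payoff \<tau>"
    and top: "topspace X \<in> range W" and W_Int: "\<And>i j. \<exists>k. W k = W i \<inter> W j"
  shows "\<exists>\<E>. countable \<E> \<and> \<Union>\<E> = topspace X \<and> (\<forall>E\<in>\<E>. \<not> escaping E)"
proof -
  define xw where "xw = (\<lambda>w. run (oblivious w) \<tau>)"
  have notpay: "xw w \<notin> payoff" for w
    using win run_odd unfolding winning_II_def xw_def by blast
  have even: "xw w (2 * n) = w n" for w n
    unfolding xw_def by (rule run_oblivious_even)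
  have agree: "xw w i = xw w' i" if "\<And>k. k < n \<Longrightarrow> w k = w' k" "i < 2 * n" for w w' n i
    unfolding xw_def by (rule run_oblivious_cong'[OF that])
  define good where "good = (\<lambda>w n x a. (\<forall>m<n. legal (xw w) m) \<and> extends (stem (xw w) n) a \<and>
     x \<in> cell (xw w) n)"
  have good_cong: "good w' n x a"
    if g: "good w n x a" and eq: "\<And>k. k < n \<Longrightarrow> w k = w' k" for w w' n x a
  proof -
    have "state (xw w) n = state (xw w') n"
      by (rule state_cong) (rule agree[OF eq])
    moreover have "legal (xw w) m = legal (xw w') m" if "m < n" for m
      by (rule legal_cong) (rule agree[OF eq], use that in auto)
    ultimately show ?thesis using g by (simp add: good_def)
  qed
  \<comment> \<open>The zeros are a mere default: only the listed moves affect the position that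
    they lead to.\<close>
  define wl :: "nat list \<Rightarrow> nat \<Rightarrow> nat" where "wl = (\<lambda>p i. if i < length p then p ! i else 0)"
  \<comment> \<open>The index \<open>2 * (length (p @ q) - 1) + 1\<close> is that of the answer to
    the last move of \<open>q\<close>.\<close>
  define ext where "ext = (\<lambda>p q x a. q \<noteq> [] \<and> xw (wl (p @ q)) (2 * (length (p @ q) - 1) + 1) \<noteq> 0 \<and>
     good (wl (p @ q)) (length (p @ q)) x a)"
  define stuck where "stuck = (\<lambda>p x a. good (wl p) (length p) x a \<and> \<not> (\<exists>q. ext p q x a))"
  have ex_stuck: "\<exists>p. stuck p x a" if a: "a \<in> Y" "x \<in> F a" for x a
  proof (rule ccontr)
    assume ns: "\<not> ?thesis"
    then have "\<exists>q. good (wl p) (length p) x a \<longrightarrow> ext p q x a" for p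
      by (auto simp: stuck_def)
    then obtain Q where Q: "\<And>p. good (wl p) (length p) x a \<Longrightarrow> ext p (Q p) x a"
      by metis
    define P where "P = rec_nat [] (\<lambda>_ p. p @ Q p)"
    have P_Suc: "P (Suc n) = P n @ Q (P n)" for n by (simp add: P_def)
    have g: "good (wl (P n)) (length (P n)) x a" for n
    proof (induction n)
      case 0
      have "x \<in> topspace X" using a cover_F by blast
      then show ?case by (simp add: P_def good_def)
    next
      case (Suc n)
      then show ?case using Q[of "P n"] unfolding P_Suc ext_def by blast
    qed
    have ext: "ext (P n) (Q (P n)) x a" for n by (rule Q[OF g])
    have len: "length (P n) \<ge> n" for n
    proof (induction n)
      case (Suc n)
      have "Q (P n) \<noteq> []" using ext[of n] by (simp add: ext_def)
      then show ?case using Suc by (cases "Q (P n)") (auto simp: P_Suc)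
    qed simp
    have nth_mono: "i < length (P m) \<and> P m ! i = P n ! i" if "n \<le> m" "i < length (P n)" for n m i
      using that
    proof (induction m)
      case (Suc m)
      then show ?case by (cases "n = Suc m") (auto simp: P_Suc nth_append)
    qed simp
    \<comment> \<open>The limit of the increasing lists; \<open>P (Suc i)\<close> is long enough to
      have an entry \<open>i\<close>.\<close>
    define w where "w = (\<lambda>i. P (Suc i) ! i)"
    have w: "wl (P n) i = w i" if "i < length (P n)" for n i
    proof -
      have "P (max n (Suc i)) ! i = P n ! i"
        using nth_mono[of n "max n (Suc i)" i] that by simp
      moreover have "P (max n (Suc i)) ! i = P (Suc i) ! i"
        using nth_mono[of "Suc i" "max n (Suc i)" i] len[of "Suc i"] by simp
      ultimately show ?thesis using that by (simp add: wl_def w_def)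
    qed
    have gw: "good w (length (P n)) x a" for n
      using good_cong[OF g w] .
    have "legal (xw w) m" for m
      using gw[of "Suc m"] len[of "Suc m"] by (simp add: good_def)
    moreover have "\<exists>n\<ge>m. xw w (2 * n + 1) \<noteq> 0" for m
    proof -
      let ?l = "length (P (Suc m))"
      have "xw (wl (P (Suc m))) (2 * (?l - 1) + 1) \<noteq> 0"
        using ext[of m] unfolding ext_def P_Suc by blast
      moreover have "xw (wl (P (Suc m))) (2 * (?l - 1) + 1) = xw w (2 * (?l - 1) + 1)"
        by (rule agree[OF w]) (use len[of "Suc m"] in auto)
      ultimately show ?thesis
        using len[of "Suc m"] by (intro exI[of _ "?l - 1"]) simp
    qed
    moreover have "extends (stem (xw w) n) a" for n
      using gw[of n] len[of n] extends_stem_antimono unfolding good_def by blast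
    ultimately have "xw w \<in> payoff"
      unfolding payoff_def using a(1) by auto
    then show False using notpay by blast
  qed
  \<comment> \<open>Besides the position, the next digit \<open>k\<close> of \<open>a\<close> is
    fixed, so that this digit can accompany every proposal of player I.\<close>
  define E where "E = (\<lambda>p k. {x. \<exists>a\<in>Y. x \<in> F a \<and> stuck p x a \<and>
     a (length (stem (xw (wl p)) (length p))) = k})"
  have cover: "(\<Union>p k. E p k) = topspace X"
  proof
    show "(\<Union>p k. E p k) \<subseteq> topspace X"
      unfolding E_def using cover_F by blast
    show "topspace X \<subseteq> (\<Union>p k. E p k)"
    proof
      fix x assume "x \<in> topspace X"
      then obtain a where a: "a \<in> Y" "x \<in> F a" using cover_F by blast
      then obtain p where "stuck p x a" using ex_stuck by blast
      then have "x \<in> E p (a (length (stem (xw (wl p)) (length p))))"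
        unfolding E_def using a by blast
      then show "x \<in> (\<Union>p k. E p k)" by blast
    qed
  qed
  have "\<not> escaping (E p k)" for p k
  proof
    assume "escaping (E p k)"
    then obtain c v z where czv: "\<And>n. z n \<in> E p k" "\<And>n. z n \<in> W (v n)"
        "\<And>n. W (v n) \<inter> W (c n) = {}" "\<And>n. W (v (Suc n)) \<subseteq> W (c n)"
        "\<And>n. W (c (Suc n)) \<subseteq> W (c n)" and empty: "(\<Inter>n. W (c n)) = {}"
      unfolding escaping_def by blast
    define t where "t = stem (xw (wl p)) (length p)"
    define B where "B = cell (xw (wl p)) (length p)"
    obtain a where a: "\<And>n. a n \<in> Y" "\<And>n. z n \<in> F (a n)" "\<And>n. stuck p (z n) (a n)"
        "\<And>n. a n (length t) = k"
      using czv(1) unfolding E_def t_def mem_Collect_eq by metis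
    have gp: "good (wl p) (length p) (z n) (a n)" for n
      using a(3)[of n] by (simp add: stuck_def)
    obtain d where d: "W d = B"
      using cell_in_range[OF top] unfolding B_def by blast
    \<comment> \<open>Intersecting with the cell \<open>B\<close> reached after \<open>p\<close>
      turns the escaping data into legal moves there.\<close>
    have "\<exists>e. W e = B \<inter> W i" for i
      using W_Int[of d i] d by simp
    then obtain inc where inc: "\<And>i. W (inc i) = B \<inter> W i" by metis
    define c' where "c' = (\<lambda>n. inc (c n))"
    define v' where "v' = (\<lambda>n. inc (v n))"
    have c': "W (c' n) = B \<inter> W (c n)" and v': "W (v' n) = B \<inter> W (v n)" for n
      by (simp_all add: c'_def v'_def inc)
    have "\<forall>n. \<exists>u. mc u = c' n \<and> mv u = v' n \<and> mk u = k"
      using ex_move by blast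
    then obtain u where u: "\<And>n. mc (u n) = c' n" "\<And>n. mv (u n) = v' n" "\<And>n. mk (u n) = k"
      by metis
    define w where "w = (\<lambda>i. if i < length p then p ! i else u (i - length p))"
    define x where "x = xw w"
    define l where "l = length p"
    have wp: "wl p i = w i" if "i < l" for i
      using that by (simp add: wl_def w_def l_def)
    have st: "state x l = (t, B)"
    proof -
      have "state (xw (wl p)) l = state x l"
        unfolding x_def by (rule state_cong) (rule agree[OF wp])
      then show ?thesis by (simp add: t_def B_def l_def prod_eq_iff)
    qed
    have xu: "x (2 * (l + m)) = u m" for m
      unfolding x_def even by (simp add: w_def l_def)
    have legp: "legal x m" if "m < l" for m
    proof -
      have "good w l (z 0) (a 0)"
        by (rule good_cong[OF gp[of 0, folded l_def] wp])
      then show ?thesis using that by (simp add: good_def x_def)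
    qed
    have zB: "z n \<in> B" for n using gp[of n] by (simp add: good_def B_def)
    have ta: "extends (t @ [k]) (a n)" for n
      using gp[of n] a(4)[of n] by (simp add: extends_snoc good_def t_def)
    \<comment> \<open>The container proposed in a round becomes the cell only in the next one, hence
      the index \<open>m - 1\<close>.\<close>
    have state_pass: "state x (l + m) = (t, if m = 0 then B else W (c' (m - 1)))"
      if "\<forall>j<m. x (2 * (l + j) + 1) = 0" for m
      using that
    proof (induction m)
      case (Suc m)
      then have "x (2 * (l + m) + 1) = 0" by simp
      then show ?case using Suc by (simp add: xu[unfolded add_mult_distrib2] u)
    qed (simp add: st)
    have legal_pass: "legal x (l + m)" if "\<forall>j<m. x (2 * (l + j) + 1) = 0" for m
    proof -
      have "W (v' m) \<subseteq> cell x (l + m)" "W (c' m) \<subseteq> cell x (l + m)"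
        using czv(4,5)[of "m - 1"] unfolding state_pass[OF that] c' v' by auto
      moreover have "W (v' m) \<inter> W (c' m) = {}" using czv(3)[of m] unfolding c' v' by blast
      moreover have "extends (stem x (l + m) @ [k]) (a m)"
        unfolding state_pass[OF that] using ta by simp
      moreover have "F (a m) \<inter> W (v' m) \<noteq> {}"
        using a(2)[of m] zB[of m] czv(2)[of m] unfolding v' by blast
      ultimately show ?thesis
        unfolding legal_def xu u using a(1) by blast
    qed
    \<comment> \<open>The first acceptance would prolong \<open>p\<close> to a position compatible
      with \<open>z m\<close> and \<open>a m\<close>, which are stuck at \<open>p\<close>.\<close>
    have pass: "x (2 * (l + m) + 1) = 0" for m
    proof (induction m rule: less_induct)
      case (less m)
      then have ps: "\<forall>j<m. x (2 * (l + j) + 1) = 0" by blast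
      show ?case
      proof (rule ccontr)
        assume acc: "x (2 * (l + m) + 1) \<noteq> 0"
        define q where "q = map u [0..<Suc m]"
        have lpq: "length (p @ q) = Suc (l + m)" by (simp add: q_def l_def)
        have wq: "w i = wl (p @ q) i" if "i < Suc (l + m)" for i
          using that by (auto simp: w_def wl_def q_def l_def nth_append simp del: upt_Suc)
        have "state x (Suc (l + m)) = (t @ [k], W (v' m))"
          using acc state_pass[OF ps] by (simp add: xu[unfolded add_mult_distrib2] u)
        moreover have "\<forall>j<Suc (l + m). legal x j"
        proof (intro allI impI)
          fix j assume j: "j < Suc (l + m)"
          show "legal x j"
          proof (cases "j < l")
            case False
            then have "legal x (l + (j - l))"
              using j ps by (intro legal_pass) auto
            then show ?thesis using False by simp
          qed (rule legp)
        qed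
        ultimately have "good w (Suc (l + m)) (z m) (a m)"
          using ta zB[of m] czv(2)[of m] v' by (simp add: good_def x_def del: state.simps)
        then have g: "good (wl (p @ q)) (length (p @ q)) (z m) (a m)"
          unfolding lpq using wq by (rule good_cong)
        have "xw (wl (p @ q)) (2 * (l + m) + 1) = x (2 * (l + m) + 1)"
          unfolding x_def by (rule agree[OF wq[symmetric]]) auto
        then have "xw (wl (p @ q)) (2 * (length (p @ q) - 1) + 1) \<noteq> 0"
          using acc unfolding lpq by simp
        then have "ext p q (z m) (a m)"
          using g by (simp add: ext_def q_def)
        then show False using a(3)[of m] by (auto simp: stuck_def)
      qed
    qed
    have leg: "legal x n" for n
      using legp[of n] legal_pass[of "n - l"] pass by (cases "n < l") auto
    have fin: "\<not> (\<forall>m. \<exists>n\<ge>m. x (2 * n + 1) \<noteq> 0)"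
    proof
      assume "\<forall>m. \<exists>n\<ge>m. x (2 * n + 1) \<noteq> 0"
      then obtain n where "n \<ge> l" "x (2 * n + 1) \<noteq> 0" by blast
      then show False using pass[of "n - l"] by simp
    qed
    \<comment> \<open>A compact value meeting all the decreasing cells would contain a point of
      their intersection, hence of every \<open>W (c n)\<close>.\<close>
    have "\<not> (\<exists>y\<in>Y. \<forall>n. F y \<inter> cell x n \<noteq> {})"
    proof
      assume "\<exists>y\<in>Y. \<forall>n. F y \<inter> cell x n \<noteq> {}"
      then obtain y where y: "y \<in> Y" "\<And>n. F y \<inter> cell x n \<noteq> {}" by blast
      have "F y \<inter> (\<Inter>n. cell x n) \<noteq> {}"
        by (rule compactin_decreasing_Int)
          (rule compact_F[OF y(1)] closedin_cell cell_Suc[OF leg] y(2))+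
      then obtain r where r: "\<And>n. r \<in> cell x n" by blast
      have "r \<in> W (c n)" for n
        using r[of "l + Suc n"] state_pass[of "Suc n"] pass c' by (simp del: state.simps)
      then show False using empty by blast
    qed
    then have "x \<in> payoff"
      unfolding payoff_def mem_Collect_eq if_not_P[OF fin] using leg by blast
    then show False using notpay x_def by blast
  qed
  then show ?thesis
    unfolding cover[symmetric] by (intro exI[of _ "range (\<lambda>(p, k). E p k)"]) auto
qed

end

section \<open>Separable metrizable images\<close>

lemma topological_basis_closure_subset:
  fixes y :: "'z::metric_space"
  assumes "topological_basis B" "open U" "y \<in> U"
  shows "\<exists>b\<in>B. y \<in> b \<and> closure b \<subseteq> U"
proof -
  obtain e where e: "e > 0" "cball y e \<subseteq> U"
    using assms(2,3) open_contains_cball by blast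
  obtain b where b: "b \<in> B" "y \<in> b" "b \<subseteq> ball y e"
    using topological_basisE[OF assms(1) open_ball centre_in_ball[THEN iffD2, OF e(1)]] by blast
  have "closure b \<subseteq> cball y e"
    by (rule closure_minimal) (use b(3) ball_subset_cball in auto)
  then show ?thesis using b e by blast
qed

context usc_cover
begin

text \<open>Determinacy leaves player II as the winner, so countably many sets that do not escape
  cover the space. The image of such a set has its closure inside the image of \<open>g\<close>: a
  limit point outside would yield escaping data.\<close>

lemma separable_metrizable_image_sigma_compact:
  fixes g :: "'a \<Rightarrow> 'z::{metric_space, second_countable_topology}"
  assumes det: "sigma_projective_determinacy"
    and no: "\<not> (\<exists>C h. closedin X C \<and>
                 perfect_map (subtopology X C) (euclidean :: (nat \<Rightarrow> nat) topology) h)"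
    and g: "continuous_map X euclidean g" and Z: "g ` topspace X \<subseteq> Z" "compact Z"
  shows "\<exists>L::nat \<Rightarrow> 'z set. (\<forall>n. compact (L n)) \<and> (\<Union>n. L n) = g ` topspace X"
proof -
  obtain B :: "'z set set" where B: "countable B" "topological_basis B"
    using ex_countable_basis by blast
  \<comment> \<open>Finite index sets make the family closed under intersections, and the empty one
    gives the whole space, as \<open>player_II_wins_imp_cover\<close> requires.\<close>
  define Wf where "Wf = (\<lambda>\<S>. {x \<in> topspace X. \<forall>b\<in>\<S>. g x \<in> closure b})"
  define \<W> where "\<W> = Wf ` {\<S>. finite \<S> \<and> \<S> \<subseteq> B}"
  have cW: "countable \<W>"
    unfolding \<W>_def using countable_Collect_finite_subset[OF B(1)] by (metis countable_image)
  have top\<W>: "topspace X \<in> \<W>"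
    unfolding \<W>_def by (rule image_eqI[of _ _ "{}"]) (auto simp: Wf_def)
  then have ne: "\<W> \<noteq> {}" by blast
  define W where "W = from_nat_into \<W>"
  have rW: "range W = \<W>"
    unfolding W_def by (rule range_from_nat_into[OF ne cW])
  have "closedin X (Wf \<S>)" for \<S>
  proof -
    have "closedin X {x \<in> topspace X. g x \<in> (\<Inter>b\<in>\<S>. closure b)}"
      by (rule closedin_continuous_map_preimage[OF g]) auto
    then show ?thesis by (simp add: Wf_def)
  qed
  then have "closedin X (W n)" for n
    using rW \<W>_def by auto (metis (no_types, lifting) image_iff rangeI)
  then interpret hurewicz_game X Y F W
    by unfold_locales
  have "determined payoff"
    using det payoff_in_hierarchy by (simp add: sigma_projective_determinacy_def sigma_projective_iff)
  then obtain \<tau> where \<tau>: "winning_II payoff \<tau>"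
    unfolding determined_def using player_I_wins_imp_perfect_preimage no by blast
  have W_Int: "\<exists>k. W k = W i \<inter> W j" for i j
  proof -
    obtain S1 S2 where S: "W i = Wf S1" "finite S1" "S1 \<subseteq> B" "W j = Wf S2" "finite S2" "S2 \<subseteq> B"
      using rW unfolding \<W>_def by (smt (verit, best) image_iff mem_Collect_eq rangeI)
    have "Wf (S1 \<union> S2) \<in> range W"
      unfolding rW \<W>_def using S by blast
    moreover have "Wf (S1 \<union> S2) = W i \<inter> W j"
      unfolding S by (auto simp: Wf_def)
    ultimately show ?thesis by (metis rangeE)
  qed
  obtain \<E> where \<E>: "countable \<E>" "\<Union>\<E> = topspace X" "\<forall>E\<in>\<E>. \<not> escaping E"
    using player_II_wins_imp_cover[OF \<tau> _ W_Int] top\<W> rW by blast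
  have idx: "\<exists>i. W i = Wf {b}" if "b \<in> B" for b
  proof -
    have "Wf {b} \<in> range W" unfolding rW \<W>_def using that by blast
    then show ?thesis by (metis rangeE)
  qed
  have cl: "closure (g ` E) \<subseteq> g ` topspace X" if E: "E \<in> \<E>" for E
  proof
    fix \<zeta> assume \<zeta>: "\<zeta> \<in> closure (g ` E)"
    show "\<zeta> \<in> g ` topspace X"
    proof (rule ccontr)
      assume nz: "\<zeta> \<notin> g ` topspace X"
      have Etop: "E \<subseteq> topspace X" using E \<E>(2) by blast
      \<comment> \<open>Basic neighbourhoods of \<zeta> are chosen with radii tending to zero, each
        leaving out the point chosen in the preceding one.\<close>
      have step: "\<exists>x b'. x \<in> E \<and> g x \<in> b \<and> b' \<in> B \<and> \<zeta> \<in> b' \<and> closure b' \<subseteq> b \<and>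
           closure b' \<subseteq> ball \<zeta> (1 / Suc n) \<and> g x \<notin> closure b'" if b: "b \<in> B" "\<zeta> \<in> b" for b and n :: nat
      proof -
        have ob: "open b" using topological_basis_open[OF B(2) b(1)] .
        then obtain x where x: "x \<in> E" "g x \<in> b"
          using \<zeta> b(2) unfolding closure_iff_nhds_not_empty by blast
        have "g x \<noteq> \<zeta>" using nz x(1) Etop by blast
        then have "open (b \<inter> ball \<zeta> (1 / Suc n) - {g x})" "\<zeta> \<in> b \<inter> ball \<zeta> (1 / Suc n) - {g x}"
          using ob b(2) by (auto intro: open_Diff)
        from topological_basis_closure_subset[OF B(2) this]
        show ?thesis using x by blast
      qed
      then obtain xx nb where xn: "\<And>b n. b \<in> B \<Longrightarrow> \<zeta> \<in> b \<Longrightarrow> xx b n \<in> E \<and> g (xx b n) \<in> b \<and>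
           nb b n \<in> B \<and> \<zeta> \<in> nb b n \<and> closure (nb b n) \<subseteq> b \<and>
           closure (nb b n) \<subseteq> ball \<zeta> (1 / Suc n) \<and> g (xx b n) \<notin> closure (nb b n)"
        by metis
      obtain b0 where b0: "b0 \<in> B" "\<zeta> \<in> b0"
        using topological_basisE[OF B(2) open_UNIV UNIV_I] by blast
      define bs where "bs = rec_nat b0 (\<lambda>n b. nb b n)"
      have bs_Suc: "bs (Suc n) = nb (bs n) n" for n by (simp add: bs_def)
      have bs: "bs n \<in> B \<and> \<zeta> \<in> bs n" for n
        by (induction n) (use b0 xn in \<open>auto simp: bs_def\<close>)
      define z where "z = (\<lambda>n. xx (bs n) n)"
      have z: "z n \<in> E" "g (z n) \<in> bs n" "closure (bs (Suc n)) \<subseteq> bs n"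
          "closure (bs (Suc n)) \<subseteq> ball \<zeta> (1 / Suc n)" "g (z n) \<notin> closure (bs (Suc n))" for n
        using xn[of "bs n" n] bs[of n] by (simp_all add: z_def bs_Suc)
      have "\<exists>v\<in>B. g (z n) \<in> v \<and> closure v \<subseteq> bs n - closure (bs (Suc n))" for n
        using z(2,5)[of n] topological_basis_open[OF B(2)] bs[of n]
        by (intro topological_basis_closure_subset[OF B(2)] open_Diff) auto
      then obtain vs where vs: "\<And>n. vs n \<in> B" "\<And>n. g (z n) \<in> vs n"
          "\<And>n. closure (vs n) \<subseteq> bs n - closure (bs (Suc n))"
        by metis
      have "\<exists>i. W i = Wf {bs (Suc n)}" "\<exists>i. W i = Wf {vs n}" for n
        using idx bs vs(1) by blast+
      \<comment> \<open>The container belonging to \<open>z n\<close> has index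
        \<open>Suc n\<close>: it comes from the first neighbourhood that leaves
        \<open>g (z n)\<close> out.\<close>
      then obtain c v where c: "\<And>n. W (c n) = Wf {bs (Suc n)}" and v: "\<And>n. W (v n) = Wf {vs n}"
        by metis
      have sub: "bs (Suc n) \<subseteq> closure (bs (Suc n))" "vs n \<subseteq> closure (vs n)" for n
        by (rule closure_subset)+
      have "escaping E"
        unfolding escaping_def
      proof (rule exI[of _ c], rule exI[of _ v], rule exI[of _ z], intro conjI allI)
        fix n
        show "z n \<in> E" by (rule z)
        show "z n \<in> W (v n)"
          unfolding v Wf_def using z(1)[of n] Etop vs(2)[of n] sub by blast
        show "W (v n) \<inter> W (c n) = {}"
          unfolding v c Wf_def using vs(3)[of n] by blast
        show "W (v (Suc n)) \<subseteq> W (c n)"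
          unfolding v c Wf_def using vs(3)[of "Suc n"] sub(1)[of n] by blast
        show "W (c (Suc n)) \<subseteq> W (c n)"
          unfolding c Wf_def using z(3)[of "Suc n"] sub(1)[of n] by blast
      next
        show "(\<Inter>n. W (c n)) = {}"
        proof (rule ccontr)
          assume "\<not> ?thesis"
          then obtain x where "\<And>n. x \<in> W (c n)" by blast
          then have x: "x \<in> topspace X" "g x \<in> closure (bs (Suc n))" for n
            unfolding c Wf_def by auto
          have lt: "dist \<zeta> (g x) < 1 / Suc n" for n
            using x(2)[of n] z(4)[of n] by (auto simp: mem_ball)
          have "g x = \<zeta>"
          proof (rule ccontr)
            assume "g x \<noteq> \<zeta>"
            then have "dist \<zeta> (g x) > 0" by simp
            then obtain n where "1 / Suc n < dist \<zeta> (g x)"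
              using nat_approx_posE by blast
            then show False using lt[of n] by simp
          qed
          then show False using nz x(1) by blast
        qed
      qed
      then show False using \<E>(3) E by blast
    qed
  qed
  have cpt: "compact (closure (g ` E))" if "E \<in> \<E>" for E
  proof -
    have "closure (g ` E) \<subseteq> Z" using cl[OF that] Z(1) by blast
    then show ?thesis using Z(2) by (metis closed_closure compact_Int_closed inf.absorb_iff2)
  qed
  define L where "L = (\<lambda>n. if \<E> = {} then {} else closure (g ` from_nat_into \<E> n))"
  have "compact (L n)" for n
    using cpt from_nat_into[of \<E> n] by (simp add: L_def)
  moreover have "(\<Union>n. L n) = g ` topspace X"
  proof
    show "(\<Union>n. L n) \<subseteq> g ` topspace X"
      using cl from_nat_into[of \<E>] by (auto simp: L_def)
    show "g ` topspace X \<subseteq> (\<Union>n. L n)"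
    proof
      fix y assume "y \<in> g ` topspace X"
      then obtain E x where E: "E \<in> \<E>" "x \<in> E" "y = g x" using \<E>(2) by blast
      then obtain n where "from_nat_into \<E> n = E"
        using from_nat_into_surj[OF \<E>(1)] by blast
      then have "y \<in> L n" using E closure_subset[of "g ` E"] by (auto simp: L_def)
      then show "y \<in> (\<Union>n. L n)" by blast
    qed
  qed
  ultimately show ?thesis by blast
qed

end

section \<open>Sigma-compact subsets\<close>

definition sigma_compact_in :: "'a topology \<Rightarrow> 'a set \<Rightarrow> bool" where
  "sigma_compact_in X S \<longleftrightarrow> (\<exists>K :: nat \<Rightarrow> 'a set. (\<forall>n. compactin X (K n)) \<and> (\<Union>n. K n) = S)"

lemma sigma_compact_in_compactin: "compactin X K \<Longrightarrow> sigma_compact_in X K"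
  unfolding sigma_compact_in_def by (intro exI[of _ "\<lambda>_. K"]) auto

lemma sigma_compact_in_UN:
  fixes S :: "nat \<Rightarrow> 'a set"
  assumes "\<And>n. sigma_compact_in X (S n)" shows "sigma_compact_in X (\<Union>n. S n)"
proof -
  obtain K where K: "\<And>n (m::nat). compactin X (K n m)" "\<And>n. (\<Union>m. K n m) = S n"
    using assms unfolding sigma_compact_in_def by metis
  have "(\<Union>i. case_prod K (prod_decode i)) = (\<Union>p. case_prod K p)"
    using surj_prod_decode by (metis image_image)
  also have "\<dots> = (\<Union>n. S n)"
    using K(2) by (auto simp: set_eq_iff)
  finally show ?thesis
    unfolding sigma_compact_in_def using K(1)
    by (intro exI[of _ "\<lambda>i. case_prod K (prod_decode i)"]) (auto split: prod.split)
qed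

lemma sigma_compact_in_Union:
  assumes "countable \<S>" "\<And>S. S \<in> \<S> \<Longrightarrow> sigma_compact_in X S" shows "sigma_compact_in X (\<Union>\<S>)"
proof (cases "\<S> = {}")
  case True
  then show ?thesis by (simp add: sigma_compact_in_compactin)
next
  case False
  then show ?thesis
    using sigma_compact_in_UN[of X "from_nat_into \<S>"] assms from_nat_into[OF False]
      range_from_nat_into[OF False assms(1)] by simp
qed

lemma sigma_compact_in_Un:
  "sigma_compact_in X S \<Longrightarrow> sigma_compact_in X T \<Longrightarrow> sigma_compact_in X (S \<union> T)"
  using sigma_compact_in_Union[of "{S, T}" X] by auto

lemma sigma_compact_in_closed_Int:
  assumes "closedin X C" "sigma_compact_in X S" shows "sigma_compact_in X (C \<inter> S)"
proof -
  obtain K :: "nat \<Rightarrow> 'a set" where K: "\<And>n. compactin X (K n)" "(\<Union>n. K n) = S"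
    using assms(2) sigma_compact_in_def by metis
  show ?thesis
    unfolding sigma_compact_in_def K(2)[symmetric]
    by (intro exI[of _ "\<lambda>n. C \<inter> K n"]) (auto intro: closed_Int_compactin assms K)
qed

lemma sigma_compact_in_fsigma_Int:
  assumes "fsigma_in X U" "sigma_compact_in X S" shows "sigma_compact_in X (U \<inter> S)"
proof -
  obtain C :: "nat \<Rightarrow> 'a set" where C: "\<And>n. closedin X (C n)" "(\<Union>n. C n) = U"
    using assms(1) unfolding fsigma_in_ascending by metis
  have "sigma_compact_in X (\<Union>n. C n \<inter> S)"
    by (intro sigma_compact_in_UN sigma_compact_in_closed_Int C assms(2))
  then show ?thesis using C(2) by (simp add: Int_UN_distrib2)
qed

section \<open>Spaces all of whose metrizable images are sigma-compact\<close>

lemma continuous_map_into_fun: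
  fixes g :: "'a \<Rightarrow> 'i \<Rightarrow> real"
  assumes "\<And>i. continuous_map X euclideanreal (\<lambda>x. g x i)"
  shows "continuous_map X euclidean g"
proof -
  have "continuous_map X (product_topology (\<lambda>_. euclideanreal) UNIV) g"
    using assms by (subst continuous_map_componentwise_UNIV) blast
  then show ?thesis by (simp only: euclidean_product_topology)
qed

lemma compact_unit_cube: "compact {h :: 'i \<Rightarrow> real. \<forall>i. h i \<in> {0..1}}"
proof -
  have "compactin (product_topology (\<lambda>_::'i. euclideanreal) UNIV) (Pi\<^sub>E UNIV (\<lambda>_. {0..1}))"
    by (simp add: compactin_PiE)
  moreover have "Pi\<^sub>E UNIV (\<lambda>_. {0..1}) = {h :: 'i \<Rightarrow> real. \<forall>i. h i \<in> {0..1}}"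
    by (auto simp: PiE_iff)
  ultimately show ?thesis
    by (simp add: euclidean_product_topology)
qed

abbreviation unit_map :: "'a topology \<Rightarrow> ('a \<Rightarrow> real) \<Rightarrow> bool" where
  "unit_map X f \<equiv> continuous_map X (top_of_set {0..1}) f"

lemma unit_mapD:
  assumes "unit_map X f"
  shows "continuous_map X euclideanreal f" "x \<in> topspace X \<Longrightarrow> f x \<in> {0..1}"
  using assms unfolding continuous_map_in_subtopology by blast+

text \<open>The negated conclusion of the theorem is assumed here, and sigma-compactness is the
  goal.\<close>

locale usc_cover_no_preimage = usc_cover +
  assumes creg: "completely_regular_space X"
    and perfect: "perfect_space X"
    and det: "sigma_projective_determinacy"
    and no_preimage: "\<not> (\<exists>C h. closedin X C \<and>
                 perfect_map (subtopology X C) (euclidean :: (nat \<Rightarrow> nat) topology) h)"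
begin

section \<open>Lindelof property and countable families of functions\<close>

lemma fsigma_in_openin: "openin X U \<Longrightarrow> fsigma_in X U"
  using perfect closedin_diff[OF closedin_topspace] openin_subset
  unfolding perfect_space_def by (subst fsigma_in_gdelta_in) blast

text \<open>A finite subfamily covering \<open>F y\<close> covers the values at all points that
  share some prefix with \<open>y\<close>, and there are only countably many prefixes.\<close>

lemma Lindelof: "Lindelof_space X"
  unfolding Lindelof_space_def
proof (intro allI impI)
  fix \<U> assume \<U>: "(\<forall>U\<in>\<U>. openin X U) \<and> \<Union>\<U> = topspace X"
  define good where "good = (\<lambda>t \<F>. finite \<F> \<and> \<F> \<subseteq> \<U> \<and> (\<forall>y\<in>Y. extends t y \<longrightarrow> F y \<subseteq> \<Union>\<F>))"
  define sel where "sel = (\<lambda>t. SOME \<F>. good t \<F>)"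
  define \<V> where "\<V> = (\<Union>t\<in>{t. \<exists>\<F>. good t \<F>}. sel t)"
  have sel: "good t (sel t)" if "\<exists>\<F>. good t \<F>" for t
    unfolding sel_def using that by (rule someI_ex)
  have "countable \<V>"
    unfolding \<V>_def using sel by (intro countable_UN) (auto simp: good_def intro: countable_finite)
  moreover have "\<V> \<subseteq> \<U>"
    unfolding \<V>_def using sel good_def by blast
  moreover have "topspace X \<subseteq> \<Union>\<V>"
  proof
    fix x assume "x \<in> topspace X"
    then obtain y where y: "y \<in> Y" "x \<in> F y" using cover_F by blast
    have "F y \<subseteq> \<Union>\<U>" using \<U> y(1) cover_F by blast
    then obtain \<F> where \<F>: "finite \<F>" "\<F> \<subseteq> \<U>" "F y \<subseteq> \<Union>\<F>"
      using compact_F[OF y(1)] \<U> unfolding compactin_def by meson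
    have "openin X (\<Union>\<F>)" using \<F>(2) \<U> by (intro openin_Union) blast
    then have "closedin X (topspace X - \<Union>\<F>)" by blast
    moreover have "F y \<inter> (topspace X - \<Union>\<F>) = {}" using \<F>(3) by blast
    ultimately have "\<exists>n. \<forall>y'\<in>Y. (\<forall>i<n. y' i = y i) \<longrightarrow> F y' \<inter> (topspace X - \<Union>\<F>) = {}"
      by (rule usc_F[OF y(1)])
    then obtain n where n: "\<forall>y'\<in>Y. (\<forall>i<n. y' i = y i) \<longrightarrow> F y' \<inter> (topspace X - \<Union>\<F>) = {}" ..
    let ?t = "map y [0..<n]"
    have "F y' \<subseteq> \<Union>\<F>" if "y' \<in> Y" "extends ?t y'" for y'
    proof -
      have "F y' \<inter> (topspace X - \<Union>\<F>) = {}" using n that by (simp add: extends_def)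
      then show ?thesis using cover_F that(1) by blast
    qed
    then have "good ?t \<F>" using \<F> by (simp add: good_def)
    then have *: "\<exists>\<F>. good ?t \<F>" ..
    have "extends ?t y" by (simp add: extends_def)
    then have "F y \<subseteq> \<Union>(sel ?t)" using sel[OF *] y(1) unfolding good_def by blast
    then show "x \<in> \<Union>\<V>" unfolding \<V>_def using y(2) * by blast
  qed
  moreover from \<open>\<V> \<subseteq> \<U>\<close> have "\<Union>\<V> \<subseteq> \<Union>\<U>" by (rule Union_mono)
  ultimately show "\<exists>\<V>. countable \<V> \<and> \<V> \<subseteq> \<U> \<and> \<Union>\<V> = topspace X"
    using \<U> by (intro exI[of _ \<V>]) simp
qed

text \<open>The space is hereditarily Lindelof: by perfectness the union is a countable union of
  closed sets, each of which is Lindelof.\<close>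

lemma countable_subfamily:
  assumes "\<forall>U\<in>\<O>. openin X U"
  shows "\<exists>\<V>. countable \<V> \<and> \<V> \<subseteq> \<O> \<and> \<Union>\<V> = \<Union>\<O>"
proof -
  have "fsigma_in X (\<Union>\<O>)"
    using assms by (intro fsigma_in_openin openin_Union) blast
  then obtain C :: "nat \<Rightarrow> 'a set" where C: "\<And>n. closedin X (C n)" "(\<Union>n. C n) = \<Union>\<O>"
    unfolding fsigma_in_ascending by metis
  have "\<exists>\<V>. countable \<V> \<and> \<V> \<subseteq> \<O> \<and> C n \<subseteq> \<Union>\<V>" for n
  proof -
    have "Lindelof_space (subtopology X (C n))"
      by (rule Lindelof_space_closedin_subtopology[OF Lindelof C(1)])
    moreover have "C n \<subseteq> \<Union>\<O>" using C(2) by blast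
    ultimately show ?thesis
      using assms unfolding Lindelof_space_subtopology_subset[OF closedin_subset[OF C(1)]] by meson
  qed
  then obtain \<V> where \<V>: "\<And>n. countable (\<V> n)" "\<And>n. \<V> n \<subseteq> \<O>" "\<And>n. C n \<subseteq> \<Union>(\<V> n)"
    by metis
  have "countable (\<Union>n. \<V> n)" using \<V>(1) by simp
  moreover have "(\<Union>n. \<V> n) \<subseteq> \<O>" using \<V>(2) by blast
  moreover have "\<Union>(\<Union>n. \<V> n) = \<Union>\<O>"
  proof
    show "\<Union>(\<Union>n. \<V> n) \<subseteq> \<Union>\<O>" using \<V>(2) by blast
    show "\<Union>\<O> \<subseteq> \<Union>(\<Union>n. \<V> n)" unfolding C(2)[symmetric] using \<V>(3) by blast
  qed
  ultimately show ?thesis by blast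
qed

text \<open>Complete regularity supplies a suitable function at each point, and countably many of
  the open sets where these exceed 1/2 suffice.\<close>

lemma subordinate_functions:
  assumes "\<forall>U\<in>\<U>. openin X U"
  shows "\<exists>f :: nat \<Rightarrow> 'a \<Rightarrow> real. (\<forall>n. unit_map X (f n)) \<and>
    (\<forall>n. \<exists>U\<in>insert {} \<U>. \<forall>x\<in>topspace X - U. f n x = 0) \<and> (\<forall>x\<in>\<Union>\<U>. \<exists>n. f n x > 1/2)"
proof -
  define \<G> where "\<G> = {f. unit_map X f \<and> (\<exists>U\<in>\<U>. \<forall>x\<in>topspace X - U. f x = (0::real))}"
  define P where "P = (\<lambda>f. {x \<in> topspace X. f x > (1/2::real)})"
  have oP: "openin X (P f)" if "f \<in> \<G>" for f
  proof -
    have "continuous_map X euclideanreal f"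
      using that unit_mapD(1) by (auto simp: \<G>_def)
    then have "openin X {x \<in> topspace X. f x \<in> {1/2<..}}"
      by (rule openin_continuous_map_preimage) simp
    then show ?thesis by (simp add: P_def)
  qed
  have "\<forall>U\<in>P ` \<G>. openin X U" using oP by auto
  from countable_subfamily[OF this]
  obtain \<V> where \<V>: "countable \<V>" "\<V> \<subseteq> P ` \<G>" "\<Union>\<V> = \<Union>(P ` \<G>)"
    by (elim exE conjE)
  then obtain \<H> where \<H>: "countable \<H>" "\<H> \<subseteq> \<G>" "\<V> = P ` \<H>"
    by (meson countable_subset_image)
  \<comment> \<open>The zero function fills in when there is nothing to enumerate; this accounts for
    the empty set added to \<U>.\<close>
  define f where "f = (\<lambda>n. if \<H> = {} then (\<lambda>_. 0) else from_nat_into \<H> n)"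
  have f: "f n = (\<lambda>_. 0) \<or> f n \<in> \<G>" for n
    using from_nat_into[of \<H> n] \<H>(2) by (auto simp: f_def)
  have "unit_map X (f n)" for n
    using f[of n] by (auto simp: \<G>_def)
  moreover have "\<exists>U\<in>insert {} \<U>. \<forall>x\<in>topspace X - U. f n x = 0" for n
    using f[of n] by (auto simp: \<G>_def)
  moreover have "\<exists>n. f n x > 1/2" if x: "x \<in> \<Union>\<U>" for x
  proof -
    obtain U where U: "U \<in> \<U>" "x \<in> U" using x by blast
    have Uo: "openin X U" using assms U(1) by blast
    have "closedin X (topspace X - U)" "x \<in> topspace X - (topspace X - U)"
      using Uo U(2) openin_subset by auto
    then obtain \<phi> where \<phi>: "unit_map X \<phi>" "\<phi> x = 0" "\<phi> ` (topspace X - U) \<subseteq> {1}"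
      using creg unfolding completely_regular_space_def by blast
    have "unit_map X (\<lambda>z. 1 - \<phi> z)"
      using \<phi>(1) by (auto simp: continuous_map_in_subtopology intro!: continuous_intros)
    moreover have "\<forall>z\<in>topspace X - U. 1 - \<phi> z = 0" using \<phi>(3) by auto
    ultimately have "(\<lambda>z. 1 - \<phi> z) \<in> \<G>"
      using U(1) unfolding \<G>_def by blast
    moreover have "x \<in> P (\<lambda>z. 1 - \<phi> z)"
      using \<phi>(2) Uo U(2) openin_subset by (auto simp: P_def)
    ultimately have "x \<in> \<Union>\<V>" unfolding \<V>(3) by blast
    then obtain h where h: "h \<in> \<H>" "x \<in> P h" using \<H>(3) by blast
    then obtain n where "from_nat_into \<H> n = h"
      using from_nat_into_surj[OF \<H>(1)] by blast
    then have "f n = h" using h(1) by (auto simp: f_def)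
    then show ?thesis using h(2) by (auto simp: P_def)
  qed
  ultimately show ?thesis by blast
qed

text \<open>Membership in \<open>D\<close> can thus be read off from countably many coordinates of a
  map into a cube.\<close>

lemma zero_functions:
  assumes "closedin X D"
  shows "\<exists>f :: nat \<Rightarrow> 'a \<Rightarrow> real. (\<forall>n. unit_map X (f n)) \<and> (\<forall>x\<in>D. \<forall>n. f n x = 0) \<and>
    (\<forall>x\<in>topspace X - D. \<exists>n. f n x \<noteq> 0)"
proof -
  have "\<forall>U\<in>{topspace X - D}. openin X U" using assms by blast
  from subordinate_functions[OF this]
  obtain f :: "nat \<Rightarrow> 'a \<Rightarrow> real" where f: "\<forall>n. unit_map X (f n)"
      "\<forall>n. \<exists>U\<in>{{}, topspace X - D}. \<forall>x\<in>topspace X - U. f n x = 0"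
      "\<forall>x\<in>\<Union>{topspace X - D}. \<exists>n. f n x > 1/2"
    by (elim exE conjE)
  have "f n x = 0" if "x \<in> D" for n x
    using f(2)[rule_format, of n] that closedin_subset[OF assms] by auto
  moreover have "\<exists>n. f n x \<noteq> 0" if "x \<in> topspace X - D" for x
  proof -
    have "\<exists>n. f n x > 1/2" using that by (intro f(3)[rule_format]) simp
    then obtain n where "f n x > 1/2" ..
    then have "f n x \<noteq> 0" by simp
    then show ?thesis ..
  qed
  ultimately show ?thesis using f(1) by blast
qed

text \<open>Removing from \<open>T\<close> all open sets with sigma-compact trace leaves a noncompact closed set, since
  countably many of them suffice; a cover witnessing this noncompactness gives the functions.\<close>

lemma escape_functions:
  assumes T: "closedin X T" "\<not> sigma_compact_in X T"
  shows "\<exists>f :: nat \<Rightarrow> 'a \<Rightarrow> real. (\<forall>n. unit_map X (f n)) \<and> (\<forall>x\<in>topspace X. \<exists>n. f n x > 1/2) \<and>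
    (\<forall>n. \<not> sigma_compact_in X {x \<in> T. \<forall>i<n. f i x \<le> 1/2})"
proof -
  define \<O> where "\<O> = {U. openin X U \<and> sigma_compact_in X (U \<inter> T)}"
  have "\<forall>U\<in>\<O>. openin X U" by (simp add: \<O>_def)
  from countable_subfamily[OF this]
  obtain \<V> where \<V>: "countable \<V>" "\<V> \<subseteq> \<O>" "\<Union>\<V> = \<Union>\<O>"
    by (elim exE conjE)
  have "sigma_compact_in X (\<Union>((\<lambda>U. U \<inter> T) ` \<V>))"
    by (rule sigma_compact_in_Union) (use \<V>(1,2) \<O>_def in auto)
  then have sO: "sigma_compact_in X (\<Union>\<O> \<inter> T)"
    using \<V>(3) by (simp flip: Int_Union2)
  define T' where "T' = T - \<Union>\<O>"
  have "openin X (\<Union>\<O>)" by (rule openin_Union) (simp add: \<O>_def)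
  then have T': "closedin X T'" unfolding T'_def using T(1) by (rule closedin_diff[rotated])
  have T_eq: "T = T' \<union> (\<Union>\<O> \<inter> T)" by (auto simp: T'_def)
  have "\<not> compactin X T'"
  proof
    assume "compactin X T'"
    then have "sigma_compact_in X (T' \<union> (\<Union>\<O> \<inter> T))"
      by (intro sigma_compact_in_Un sigma_compact_in_compactin sO)
    then show False using T(2) T_eq by simp
  qed
  then have "\<exists>\<C>. (\<forall>U\<in>\<C>. openin X U) \<and> T' \<subseteq> \<Union>\<C> \<and> (\<forall>\<F>\<subseteq>\<C>. finite \<F> \<longrightarrow> \<not> T' \<subseteq> \<Union>\<F>)"
    using closedin_subset[OF T'] by (simp add: compactin_def)
  then obtain \<C> where \<C>: "\<forall>U\<in>\<C>. openin X U" "T' \<subseteq> \<Union>\<C>"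
      "\<forall>\<F>\<subseteq>\<C>. finite \<F> \<longrightarrow> \<not> T' \<subseteq> \<Union>\<F>"
    by (elim exE conjE)
  \<comment> \<open>The complement of \<open>T'\<close> makes this a cover of the whole space but
    contributes nothing to covering \<open>T'\<close>.\<close>
  have "\<forall>U\<in>insert (topspace X - T') \<C>. openin X U"
    using \<C>(1) T' by blast
  from subordinate_functions[OF this]
  obtain f :: "nat \<Rightarrow> 'a \<Rightarrow> real" where f': "\<forall>n. unit_map X (f n)"
      and f2: "\<forall>n. \<exists>U\<in>insert {} (insert (topspace X - T') \<C>). \<forall>x\<in>topspace X - U. f n x = 0"
      and f3: "\<forall>x\<in>\<Union>(insert (topspace X - T') \<C>). \<exists>n. f n x > 1/2"
    by (elim exE conjE)
  have f: "unit_map X (f n)" for n using f' ..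
  have cov: "\<exists>n. f n x > 1/2" if "x \<in> topspace X" for x
    using that \<C>(2) by (intro f3[rule_format]) auto
  obtain u where u: "\<And>n. u n \<in> insert {} (insert (topspace X - T') \<C>)"
      "\<And>n x. x \<in> topspace X - u n \<Longrightarrow> f n x = 0"
    using f2 by metis
  have "\<not> sigma_compact_in X {x \<in> T. \<forall>i<n. f i x \<le> 1/2}" for n
  proof
    assume sc: "sigma_compact_in X {x \<in> T. \<forall>i<n. f i x \<le> 1/2}"
    have "\<not> T' \<subseteq> \<Union>((u ` {..<n}) \<inter> \<C>)"
      by (rule \<C>(3)[rule_format]) auto
    then obtain x where x: "x \<in> T'" "\<And>i. i < n \<Longrightarrow> u i \<in> \<C> \<Longrightarrow> x \<notin> u i" by blast
    have xt: "x \<in> topspace X" using x(1) T' closedin_subset by blast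
    have fx: "f i x = 0" if "i < n" for i
      using u(1)[of i] x that xt by (intro u(2)) auto
    \<comment> \<open>On this neighbourhood of \<open>x\<close> the inequalities hold, so its trace
      on \<open>T\<close> is sigma-compact and \<open>x\<close> would have been removed from
      \<open>T'\<close>.\<close>
    define U where "U = topspace X \<inter> (\<Inter>i\<in>{..<n}. {z \<in> topspace X. f i z < 1/2})"
    have "openin X {z \<in> topspace X. f i z \<in> {..<1/2}}" for i
      by (rule openin_continuous_map_preimage[OF unit_mapD(1)[OF f]]) simp
    then have oi: "openin X {z \<in> topspace X. f i z < 1/2}" for i by simp
    have U: "openin X U"
    proof (cases "n = 0")
      case False
      then show ?thesis unfolding U_def by (intro openin_Int openin_INT2 oi) auto
    qed (simp add: U_def)
    have "sigma_compact_in X (U \<inter> {x \<in> T. \<forall>i<n. f i x \<le> 1/2})"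
      by (rule sigma_compact_in_fsigma_Int[OF fsigma_in_openin[OF U] sc])
    moreover have "U \<inter> {x \<in> T. \<forall>i<n. f i x \<le> 1/2} = U \<inter> T"
      by (force simp: U_def)
    ultimately have "U \<in> \<O>" using U by (simp add: \<O>_def)
    moreover have "x \<in> U" using xt fx by (simp add: U_def)
    ultimately show False using x(1) by (auto simp: T'_def)
  qed
  then show ?thesis using f cov by (intro exI[of _ f] conjI) simp_all
qed

lemma cube_image_sigma_compact:
  fixes g :: "'a \<Rightarrow> 'i::countable \<Rightarrow> real"
  assumes "\<And>i. unit_map X (\<lambda>x. g x i)"
  shows "\<exists>L::nat \<Rightarrow> ('i \<Rightarrow> real) set. (\<forall>n. compact (L n)) \<and> (\<Union>n. L n) = g ` topspace X"
proof (rule separable_metrizable_image_sigma_compact[OF det no_preimage _ _ compact_unit_cube])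
  show "continuous_map X euclidean g"
    by (rule continuous_map_into_fun[OF unit_mapD(1)[OF assms]])
  show "g ` topspace X \<subseteq> {h. \<forall>i. h i \<in> {0..1}}"
    using unit_mapD(2)[OF assms] by blast
qed

text \<open>The coordinates detect the closures \<open>D t\<close>. If \<open>x\<close> is in
  \<open>F y\<close>, its fibre lies in \<open>D t\<close> for every prefix \<open>t\<close> of
  \<open>y\<close>; by semicontinuity and regularity it is then a closed part of the compact set
  \<open>F y\<close>.\<close>

lemma compact_fibre_map:
  "\<exists>g :: 'a \<Rightarrow> nat list \<times> nat \<Rightarrow> real. (\<forall>i. unit_map X (\<lambda>x. g x i)) \<and>
     (\<forall>q. compactin X {x \<in> topspace X. g x = q})"
proof -
  define D where "D = (\<lambda>t. X closure_of (\<Union>y\<in>{y \<in> Y. extends t y}. F y))"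
  have "\<forall>t. \<exists>f :: nat \<Rightarrow> 'a \<Rightarrow> real. (\<forall>n. unit_map X (f n)) \<and> (\<forall>x\<in>D t. \<forall>n. f n x = 0) \<and>
    (\<forall>x\<in>topspace X - D t. \<exists>n. f n x \<noteq> 0)"
    unfolding D_def by (intro allI zero_functions closedin_closure_of)
  from choice[OF this] obtain f :: "nat list \<Rightarrow> nat \<Rightarrow> 'a \<Rightarrow> real"
    where f: "\<forall>t. (\<forall>n. unit_map X (f t n)) \<and> (\<forall>x\<in>D t. \<forall>n. f t n x = 0) \<and>
      (\<forall>x\<in>topspace X - D t. \<exists>n. f t n x \<noteq> 0)" ..
  define g where "g = (\<lambda>x (t, n). f t n x)"
  have um: "unit_map X (\<lambda>x. g x i)" for i
    using f by (cases i) (simp add: g_def)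
  have "compactin X {x \<in> topspace X. g x = q}" for q
  proof (cases "{x \<in> topspace X. g x = q} = {}")
    case False
    then obtain x where x: "x \<in> topspace X" "g x = q" by blast
    then obtain y where y: "y \<in> Y" "x \<in> F y" using cover_F by blast
    have "z \<in> F y" if z: "z \<in> topspace X" "g z = q" for z
    proof (rule ccontr)
      assume "z \<notin> F y"
      then obtain U V where U: "openin X U" "openin X V" "z \<in> U" "F y \<subseteq> V" "disjnt U V"
        using regular closed_F[OF y(1)] z(1) unfolding regular_space_def by (metis DiffI)
      have "closedin X (topspace X - V)" "F y \<inter> (topspace X - V) = {}" using U by auto
      from usc_F[OF y(1) this]
      obtain n where n: "\<forall>y'\<in>Y. (\<forall>i<n. y' i = y i) \<longrightarrow> F y' \<inter> (topspace X - V) = {}" ..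
      let ?t = "map y [0..<n]"
      have "F y' \<inter> U = {}" if "y' \<in> Y" "extends ?t y'" for y'
      proof -
        have "F y' \<inter> (topspace X - V) = {}" using n that by (simp add: extends_def)
        then show ?thesis using U(5) openin_subset[OF U(1)] by (auto simp: disjnt_iff)
      qed
      then have "z \<notin> D ?t"
        unfolding D_def in_closure_of using U(1,3) by blast
      then obtain m where "f ?t m z \<noteq> 0" using f z(1) by blast
      moreover have "x \<in> D ?t"
      proof -
        have "extends ?t y" by (simp add: extends_def)
        then have "x \<in> (\<Union>y\<in>{y \<in> Y. extends ?t y}. F y)" using y by blast
        moreover have "(\<Union>y\<in>{y \<in> Y. extends ?t y}. F y) \<subseteq> topspace X" using cover_F by blast
        ultimately show ?thesis unfolding D_def using closure_of_subset by blast
      qed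
      then have "f ?t m x = 0" using f by blast
      moreover have "f ?t m x = f ?t m z"
      proof -
        have "g x (?t, m) = g z (?t, m)" using x(2) z(2) by simp
        then show ?thesis by (simp add: g_def)
      qed
      ultimately show False by simp
    qed
    then have "{x \<in> topspace X. g x = q} \<subseteq> F y" by blast
    moreover have "closedin X {x \<in> topspace X. g x = q}"
      using closedin_continuous_map_preimage[OF continuous_map_into_fun[OF unit_mapD(1)[OF um]], of "{q}"]
      by simp
    ultimately show ?thesis using closed_compactin[OF compact_F[OF y(1)]] by blast
  next
    case True
    then show ?thesis by (simp only: compactin_empty)
  qed
  then show ?thesis using um by (intro exI[of _ g]) simp
qed

text \<open>One step of the tree construction. The part of \<open>T\<close> where the first
  \<open>n\<close> functions are at most 1/2 is cut into countably many closed pieces by the compact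
  pieces of a cube image; one piece is not sigma-compact.\<close>

lemma non_sigma_compact_splitting:
  fixes g :: "'a \<Rightarrow> 'i::countable \<Rightarrow> real"
  assumes g: "\<And>i. unit_map X (\<lambda>x. g x i)" and T: "closedin X T" "\<not> sigma_compact_in X T"
  shows "\<exists>(f :: nat \<Rightarrow> 'a \<Rightarrow> real) S. (\<forall>n. unit_map X (f n)) \<and> (\<forall>x\<in>topspace X. \<exists>n. f n x > 1/2) \<and>
    (\<forall>n::nat. closedin X (S n) \<and> S n \<subseteq> T \<and> \<not> sigma_compact_in X (S n) \<and> compact (g ` S n) \<and>
       (\<forall>x\<in>S n. \<forall>i<n. f i x \<le> 1/2))"
proof -
  from escape_functions[OF T] obtain f :: "nat \<Rightarrow> 'a \<Rightarrow> real"
    where f: "\<forall>n. unit_map X (f n)" "\<forall>x\<in>topspace X. \<exists>n. f n x > 1/2"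
      "\<forall>n. \<not> sigma_compact_in X {x \<in> T. \<forall>i<n. f i x \<le> 1/2}"
    by (elim exE conjE)
  have "\<exists>S. closedin X S \<and> S \<subseteq> T \<and> \<not> sigma_compact_in X S \<and> compact (g ` S) \<and>
       (\<forall>x\<in>S. \<forall>i<n. f i x \<le> 1/2)" for n :: nat
  proof -
    define R where "R = {x \<in> T. \<forall>i<n. f i x \<le> 1/2}"
    have nR: "\<not> sigma_compact_in X R" using f(3) by (simp add: R_def)
    have cf: "closedin X {x \<in> topspace X. f i x \<in> {..1/2}}" for i
      by (rule closedin_continuous_map_preimage[OF unit_mapD(1)]) (use f(1) in auto)
    have "closedin X (T \<inter> (\<Inter>i\<in>{..<n}. {x \<in> topspace X. f i x \<in> {..1/2}}))"
    proof (cases "n = 0")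
      case False
      then show ?thesis by (intro closedin_Int closedin_INT T cf) auto
    qed (simp add: T)
    moreover have "T \<inter> (\<Inter>i\<in>{..<n}. {x \<in> topspace X. f i x \<in> {..1/2}}) = R"
      using closedin_subset[OF T(1)] by (auto simp: R_def)
    ultimately have R: "closedin X R" by simp
    from zero_functions[OF R] obtain h :: "nat \<Rightarrow> 'a \<Rightarrow> real"
      where h: "\<forall>n. unit_map X (h n)" "\<forall>x\<in>R. \<forall>n. h n x = 0" "\<forall>x\<in>topspace X - R. \<exists>n. h n x \<noteq> 0"
      by (elim exE conjE)
    \<comment> \<open>The coordinates taken from \<open>h\<close> make \<open>R\<close> the preimage
      of a closed set.\<close>
    define g' where "g' = (\<lambda>x (i :: 'i + nat). case i of Inl j \<Rightarrow> g x j | Inr m \<Rightarrow> h m x)"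
    have um: "unit_map X (\<lambda>x. g' x i)" for i
      using g h(1) by (cases i) (auto simp: g'_def)
    from cube_image_sigma_compact[of g', OF um]
    obtain L :: "nat \<Rightarrow> ('i + nat \<Rightarrow> real) set" where
      L: "\<forall>n. compact (L n)" "(\<Union>n. L n) = g' ` topspace X" by (elim exE conjE)
    define L0 where "L0 = (\<lambda>j. L j \<inter> {z. \<forall>m. z (Inr m) = 0})"
    define S where "S = (\<lambda>j. {x \<in> topspace X. g' x \<in> L0 j})"
    have "closed {z :: 'i + nat \<Rightarrow> real. \<forall>m. z (Inr m) = 0}"
      by (intro closed_Collect_all closed_Collect_eq) auto
    then have cL0: "compact (L0 j)" for j
      using L(1) by (simp add: L0_def compact_Int_closed)
    have inR: "x \<in> R \<longleftrightarrow> (\<forall>m. h m x = 0)" if "x \<in> topspace X" for x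
      using h(2,3) that by blast
    have R_eq: "R = (\<Union>j. S j)"
    proof
      show "R \<subseteq> (\<Union>j. S j)"
      proof
        fix x assume x: "x \<in> R"
        then have xt: "x \<in> topspace X" using closedin_subset[OF R] by blast
        then have "g' x \<in> (\<Union>n. L n)" unfolding L(2) by blast
        then obtain j where "g' x \<in> L j" by blast
        then have "x \<in> S j" using xt h(2) x by (simp add: S_def L0_def g'_def)
        then show "x \<in> (\<Union>j. S j)" by blast
      qed
      show "(\<Union>j. S j) \<subseteq> R"
      proof clarify
        fix x j assume "x \<in> S j"
        then have "x \<in> topspace X" "\<forall>m. g' x (Inr m) = 0" by (simp_all add: S_def L0_def)
        then show "x \<in> R" using inR by (simp add: g'_def)
      qed
    qed
    obtain j where j: "\<not> sigma_compact_in X (S j)"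
      using nR sigma_compact_in_UN[of X S] unfolding R_eq by blast
    have "closedin X (S j)"
      unfolding S_def
      by (rule closedin_continuous_map_preimage[OF continuous_map_into_fun[OF unit_mapD(1)[OF um]]])
        (simp add: compact_imp_closed[OF cL0])
    moreover have "S j \<subseteq> R" using R_eq by blast
    moreover have "compact (g ` S j)"
    proof -
      have "continuous_on (L0 j) (\<lambda>z i. z (Inl i))"
        by (intro continuous_on_coordinatewise_then_product
            continuous_on_subset[OF continuous_on_product_coordinates]) auto
      then have "compact ((\<lambda>z i. z (Inl i)) ` L0 j)"
        using cL0 compact_continuous_image by blast
      \<comment> \<open>Equality holds because \<open>L j\<close> is contained in the image of
        \<open>g'\<close>.\<close>
      moreover have "(\<lambda>z i. z (Inl i)) ` L0 j = g ` S j"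
      proof
        show "g ` S j \<subseteq> (\<lambda>z i. z (Inl i)) ` L0 j"
        proof clarify
          fix x assume "x \<in> S j"
          then show "g x \<in> (\<lambda>z i. z (Inl i)) ` L0 j"
            by (intro image_eqI[of _ _ "g' x"]) (auto simp: S_def g'_def)
        qed
        show "(\<lambda>z i. z (Inl i)) ` L0 j \<subseteq> g ` S j"
        proof clarify
          fix z assume z: "z \<in> L0 j"
          then have "z \<in> g' ` topspace X" unfolding L(2)[symmetric] by (auto simp: L0_def)
          then obtain x where x: "x \<in> topspace X" "z = g' x" by blast
          then have "x \<in> S j" using z by (simp add: S_def)
          moreover have "(\<lambda>i. z (Inl i)) = g x" by (simp add: x(2) g'_def)
          ultimately show "(\<lambda>i. z (Inl i)) \<in> g ` S j" by blast
        qed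
      qed
      ultimately show ?thesis by simp
    qed
    ultimately show ?thesis
      using j by (intro exI[of _ "S j"]) (auto simp: R_def)
  qed
  then have "\<forall>n. \<exists>S. closedin X S \<and> S \<subseteq> T \<and> \<not> sigma_compact_in X S \<and> compact (g ` S) \<and>
       (\<forall>x\<in>S. \<forall>i<n. f i x \<le> 1/2)" by blast
  from choice[OF this] obtain S where S: "\<forall>n. closedin X (S n) \<and> S n \<subseteq> T \<and>
       \<not> sigma_compact_in X (S n) \<and> compact (g ` S n) \<and> (\<forall>x\<in>S n. \<forall>i<n. f i x \<le> 1/2)" ..
  show ?thesis
    by (rule exI[of _ f], rule exI[of _ S]) (intro conjI f(1,2) S)
qed

text \<open>Iterating the splitting gives a tree of closed sets. Their images in the compact-fibre map are
  compact, so every branch has a common point; a branch that escapes faster and faster shows that the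
  map collecting all the splitting functions has an image that is not sigma-compact.\<close>

lemma sigma_compact: "sigma_compact_in X (topspace X)"
proof (rule ccontr)
  assume nsc: "\<not> sigma_compact_in X (topspace X)"
  from compact_fibre_map obtain g :: "'a \<Rightarrow> nat list \<times> nat \<Rightarrow> real"
    where g: "\<forall>i. unit_map X (\<lambda>x. g x i)" "\<forall>q. compactin X {x \<in> topspace X. g x = q}"
    by (elim exE conjE)
  define bad where "bad = (\<lambda>T. closedin X T \<and> \<not> sigma_compact_in X T)"
  have "\<forall>T. \<exists>p :: (nat \<Rightarrow> 'a \<Rightarrow> real) \<times> (nat \<Rightarrow> 'a set). bad T \<longrightarrow>
    (\<forall>n. unit_map X (fst p n)) \<and> (\<forall>x\<in>topspace X. \<exists>n. fst p n x > 1/2) \<and>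
    (\<forall>n. closedin X (snd p n) \<and> snd p n \<subseteq> T \<and> \<not> sigma_compact_in X (snd p n) \<and>
       compact (g ` snd p n) \<and> (\<forall>x\<in>snd p n. \<forall>i<n. fst p i x \<le> 1/2))"
  proof
    fix T
    show "\<exists>p :: (nat \<Rightarrow> 'a \<Rightarrow> real) \<times> (nat \<Rightarrow> 'a set). bad T \<longrightarrow>
      (\<forall>n. unit_map X (fst p n)) \<and> (\<forall>x\<in>topspace X. \<exists>n. fst p n x > 1/2) \<and>
      (\<forall>n. closedin X (snd p n) \<and> snd p n \<subseteq> T \<and> \<not> sigma_compact_in X (snd p n) \<and>
         compact (g ` snd p n) \<and> (\<forall>x\<in>snd p n. \<forall>i<n. fst p i x \<le> 1/2))"
    proof (cases "bad T")
      case True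
      have gi: "\<And>i. unit_map X (\<lambda>x. g x i)" using g(1) by blast
      from non_sigma_compact_splitting[of g T, OF gi] True
      obtain f :: "nat \<Rightarrow> 'a \<Rightarrow> real" and S where
        "(\<forall>n. unit_map X (f n)) \<and> (\<forall>x\<in>topspace X. \<exists>n. f n x > 1/2) \<and>
        (\<forall>n::nat. closedin X (S n) \<and> S n \<subseteq> T \<and> \<not> sigma_compact_in X (S n) \<and> compact (g ` S n) \<and>
           (\<forall>x\<in>S n. \<forall>i<n. f i x \<le> 1/2))"
        unfolding bad_def by (elim conjE) (elim meta_impE exE, assumption+)
      then show ?thesis by (intro exI[of _ "(f, S)"]) simp
    qed simp
  qed
  from choice[OF this] obtain p :: "'a set \<Rightarrow> (nat \<Rightarrow> 'a \<Rightarrow> real) \<times> (nat \<Rightarrow> 'a set)"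
    where p: "\<forall>T. bad T \<longrightarrow>
    (\<forall>n. unit_map X (fst (p T) n)) \<and> (\<forall>x\<in>topspace X. \<exists>n. fst (p T) n x > 1/2) \<and>
    (\<forall>n. closedin X (snd (p T) n) \<and> snd (p T) n \<subseteq> T \<and> \<not> sigma_compact_in X (snd (p T) n) \<and>
       compact (g ` snd (p T) n) \<and> (\<forall>x\<in>snd (p T) n. \<forall>i<n. fst (p T) i x \<le> 1/2))" ..
  \<comment> \<open>The newest index stands at the head of the list, so the tail is the parent
    node.\<close>
  define tree where "tree = rec_list (topspace X) (\<lambda>n _ T. snd (p T) n)"
  have tree_Nil: "tree [] = topspace X" and tree_Cons: "tree (n # l) = snd (p (tree l)) n" for n l
    by (simp_all add: tree_def)
  have bad: "bad (tree l)" for l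
  proof (induction l)
    case Nil
    then show ?case using nsc by (simp add: tree_Nil bad_def)
  next
    case (Cons n l)
    then show ?case using p unfolding tree_Cons bad_def by blast
  qed
  define \<phi> where "\<phi> = (\<lambda>l. fst (p (tree l)))"
  have \<phi>: "unit_map X (\<phi> l n)" "x \<in> topspace X \<Longrightarrow> \<exists>n. \<phi> l n x > 1/2" for l n x
    using p bad[of l] unfolding \<phi>_def by blast+
  have sub: "tree (n # l) \<subseteq> tree l" "compact (g ` tree (n # l))"
      "x \<in> tree (n # l) \<Longrightarrow> i < n \<Longrightarrow> \<phi> l i x \<le> 1/2" for n l x i
    using p bad[of l] unfolding \<phi>_def tree_Cons by blast+
  define G where "G = (\<lambda>x (l, n). \<phi> l n x)"
  have "unit_map X (\<lambda>x. G x i)" for i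
    using \<phi>(1) by (cases i) (simp add: G_def)
  from cube_image_sigma_compact[of G, OF this]
  obtain L :: "nat \<Rightarrow> (nat list \<times> nat \<Rightarrow> real) set"
    where L: "\<forall>n. compact (L n)" "(\<Union>n. L n) = G ` topspace X" by (elim exE conjE)
  \<comment> \<open>By compactness of \<open>L n\<close>, boundedly many functions of the node
    \<open>l\<close> suffice to exceed 1/2 somewhere at each point of it.\<close>
  have "\<exists>b. \<forall>z\<in>L n. \<exists>i<b. z (l, i) > 1/2" for l n
  proof -
    define O' where "O' = (\<lambda>i. {z :: nat list \<times> nat \<Rightarrow> real. z (l, i) > 1/2})"
    have "open (O' i)" for i
      unfolding O'_def by (intro open_Collect_less) auto
    moreover have "L n \<subseteq> (\<Union>i. O' i)"
    proof
      fix z assume "z \<in> L n"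
      then have "z \<in> G ` topspace X" using L(2) by blast
      then obtain x where "x \<in> topspace X" "z = G x" by blast
      moreover from this(1) obtain i where "\<phi> l i x > 1/2" using \<phi>(2) by blast
      ultimately have "z \<in> O' i" by (simp add: O'_def G_def)
      then show "z \<in> (\<Union>i. O' i)" by blast
    qed
    ultimately obtain J where J: "finite J" "L n \<subseteq> (\<Union>i\<in>J. O' i)"
      using compactE_image[of "L n" UNIV O'] L(1) by (metis subset_UNIV)
    obtain b where b: "\<forall>i\<in>J. i < b" using J(1) finite_nat_set_iff_bounded by blast
    have "\<exists>i<b. z (l, i) > 1/2" if z: "z \<in> L n" for z
    proof -
      obtain i where "i \<in> J" "z \<in> O' i" using J(2) z by blast
      then show ?thesis using b by (auto simp: O'_def)
    qed
    then show ?thesis by blast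
  qed
  then have "\<forall>l. \<forall>n. \<exists>b. \<forall>z\<in>L n. \<exists>i<b. z (l, i) > 1/2" by blast
  then obtain b where b: "\<And>l n z. z \<in> L n \<Longrightarrow> \<exists>i<b l n. z (l, i) > 1/2"
    by metis
  \<comment> \<open>A diagonal branch: at depth \<open>k\<close> the successor is so far out that
    \<open>G\<close> sends none of its points into \<open>L k\<close>.\<close>
  define B where "B = rec_nat [] (\<lambda>k l. b l k # l)"
  have B_Suc: "B (Suc k) = b (B k) k # B k" for k by (simp add: B_def)
  \<comment> \<open>The root is skipped because compactness of the image under \<open>g\<close> is
    provided for successor nodes only.\<close>
  define T where "T = (\<lambda>k. tree (B (Suc k)))"
  have T_cl: "closedin X (T k)" for k
    using bad unfolding T_def bad_def by blast
  have T_dec: "T (Suc k) \<subseteq> T k" for k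
    unfolding T_def B_Suc[of "Suc k"] by (rule sub(1))
  have T_ne: "T k \<noteq> {}" for k
    using bad[of "B (Suc k)"] sigma_compact_in_compactin[of X "{}"] unfolding T_def bad_def by auto
  have T_cpt: "compact (g ` T k)" for k
    unfolding T_def B_Suc by (rule sub(2))
  have "(\<Inter>k. g ` T k) \<noteq> {}"
  proof -
    have "compactin euclidean (g ` T 0)" using T_cpt by simp
    then have "g ` T 0 \<inter> (\<Inter>k. g ` T k) \<noteq> {}"
    proof (rule compactin_decreasing_Int)
      fix k
      show "closedin euclidean (g ` T k)" using T_cpt compact_imp_closed by auto
      show "g ` T (Suc k) \<subseteq> g ` T k" using T_dec by blast
      have "T k \<subseteq> T 0" using lift_Suc_antimono_le[of T, OF T_dec, of 0 k] by simp
      then show "g ` T 0 \<inter> g ` T k \<noteq> {}" using T_ne[of k] by blast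
    qed
    then show ?thesis by blast
  qed
  then obtain q where q: "\<And>k. q \<in> g ` T k" by blast
  \<comment> \<open>All sets of the branch meet the compact fibre over \<open>q\<close>, so they
    have a common point there.\<close>
  have "{x \<in> topspace X. g x = q} \<inter> (\<Inter>k. T k) \<noteq> {}"
  proof (rule compactin_decreasing_Int)
    show "compactin X {x \<in> topspace X. g x = q}" using g(2) ..
    fix k
    show "closedin X (T k)" "T (Suc k) \<subseteq> T k" by (rule T_cl T_dec)+
    obtain x where "x \<in> T k" "g x = q" using q[of k] by blast
    then show "{x \<in> topspace X. g x = q} \<inter> T k \<noteq> {}"
      using closedin_subset[OF T_cl[of k]] by blast
  qed
  then obtain x where x: "x \<in> topspace X" "\<And>k. x \<in> T k" by blast
  have "G x \<in> (\<Union>n. L n)" unfolding L(2) using x(1) by blast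
  then obtain k where "G x \<in> L k" by blast
  then obtain i where i: "i < b (B k) k" "G x (B k, i) > 1/2" using b by blast
  have "\<phi> (B k) i x \<le> 1/2"
    using x(2)[of k] i(1) unfolding T_def B_Suc by (rule sub(3))
  then show False using i(2) by (simp add: G_def)
qed

end

section \<open>Closures of compact values and the conclusion\<close>

lemma regular_compactin_closure_of_disjoint:
  assumes "regular_space X" "compactin X K" "closedin X C" "K \<inter> C = {}"
  shows "X closure_of K \<inter> C = {}"
proof -
  obtain U V where U: "openin X U" "openin X V" "K \<subseteq> U" "C \<subseteq> V" "disjnt U V"
    using regular_space_compact_closed_separation[OF assms(1-3)] assms(4) by (auto simp: disjnt_def)
  have "X closure_of K \<subseteq> topspace X - V"
    using U openin_subset[OF U(1)] by (intro closure_of_minimal) (auto simp: disjnt_iff)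
  then show ?thesis using U(4) by blast
qed

text \<open>By regularity, finitely many open sets covering a compact set also cover its closure.
  This allows the values of a multifunction to be made closed.\<close>

lemma regular_compactin_closure_of:
  assumes "regular_space X" "compactin X K"
  shows "compactin X (X closure_of K)"
  unfolding compactin_def
proof (intro conjI allI impI)
  fix \<U> assume \<U>: "Ball \<U> (openin X) \<and> X closure_of K \<subseteq> \<Union>\<U>"
  have "K \<subseteq> \<Union>\<U>"
    using \<U> closure_of_subset[OF compactin_subset_topspace[OF assms(2)]] by blast
  then obtain \<F> where \<F>: "finite \<F>" "\<F> \<subseteq> \<U>" "K \<subseteq> \<Union>\<F>"
    using assms(2) \<U> unfolding compactin_def by metis
  have "openin X (\<Union>\<F>)" using \<F>(2) \<U> by (intro openin_Union) auto
  then have "X closure_of K \<inter> (topspace X - \<Union>\<F>) = {}"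
    using \<F>(3) by (intro regular_compactin_closure_of_disjoint assms) auto
  then have "X closure_of K \<subseteq> \<Union>\<F>"
    using closure_of_subset_topspace[of X K] by blast
  then show "\<exists>\<F>. finite \<F> \<and> \<F> \<subseteq> \<U> \<and> X closure_of K \<subseteq> \<Union>\<F>"
    using \<F>(1,2) by (intro exI[of _ \<F>]) simp
qed (rule closure_of_subset_topspace)

theorem theorem6p16:
  fixes X :: "'a topology"
  assumes "sigma_projective_determinacy"
    and "completely_regular_space X"
    and "perfect_space X"
    and "in_class_K X"
    and "\<not> sigma_compact_space X"
  shows "\<exists>C f. closedin X C \<and>
           perfect_map (subtopology X C) (euclidean :: (nat \<Rightarrow> nat) topology) f"
proof (rule ccontr)
  assume no: "\<not> ?thesis"
  obtain A :: "real set" and F where A: "sigma_projective A" and F: "USCCV (top_of_set A) X F"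
      and cover: "(\<Union>a\<in>A. F a) = topspace X"
    using assms(4) unfolding in_class_K_def by blast
  have reg: "regular_space X"
    by (rule completely_regular_imp_regular_space[OF assms(2)])
  \<comment> \<open>The parameters are moved from the reals to Baire space, and the values are
    replaced by their closures.\<close>
  define Y where "Y = {y. baire_to_real y \<in> A}"
  define H where "H = (\<lambda>y. X closure_of F (baire_to_real y))"
  have cF: "compactin X (F (baire_to_real y))" if "y \<in> Y" for y
    using F that by (simp add: USCCV_def Y_def)
  interpret usc_cover_no_preimage X Y H
  proof unfold_locales
    fix y assume y: "y \<in> Y"
    show "compactin X (H y)"
      unfolding H_def by (rule regular_compactin_closure_of[OF reg cF[OF y]])
    show "closedin X (H y)" by (simp add: H_def)
    fix C assume C: "closedin X C" "H y \<inter> C = {}"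
    have "F (baire_to_real y) \<subseteq> H y"
      unfolding H_def by (rule closure_of_subset[OF compactin_subset_topspace[OF cF[OF y]]])
    then have "F (baire_to_real y) \<inter> C = {}" using C(2) by blast
    moreover have "closedin (top_of_set A) {a \<in> A. F a \<inter> C \<noteq> {}}"
      using F C(1) by (simp add: USCCV_def)
    then obtain D where D: "closed D" "{a \<in> A. F a \<inter> C \<noteq> {}} = A \<inter> D"
      unfolding closedin_closed by blast
    ultimately have "y \<in> baire_to_real -` (- D)" using y unfolding Y_def by blast
    moreover have "open (baire_to_real -` (- D))"
      using D(1) by (intro open_vimage continuous_on_baire_to_real) auto
    ultimately obtain n where n: "\<And>y'. (\<forall>i<n. y' i = y i) \<Longrightarrow> y' \<in> baire_to_real -` (- D)"
      unfolding open_baire_iff by blast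
    have "H y' \<inter> C = {}" if y': "y' \<in> Y" "\<forall>i<n. y' i = y i" for y'
    proof -
      have "F (baire_to_real y') \<inter> C = {}"
        using n[OF y'(2)] y'(1) D(2) unfolding Y_def by blast
      then show ?thesis
        unfolding H_def by (intro regular_compactin_closure_of_disjoint reg cF y' C)
    qed
    then show "\<exists>n. \<forall>y'\<in>Y. (\<forall>i<n. y' i = y i) \<longrightarrow> H y' \<inter> C = {}" by blast
  next
    show "(\<Union>y\<in>Y. H y) = topspace X"
    proof
      show "(\<Union>y\<in>Y. H y) \<subseteq> topspace X"
        unfolding H_def by (intro UN_least closure_of_subset_topspace)
      show "topspace X \<subseteq> (\<Union>y\<in>Y. H y)"
      proof
        fix x assume "x \<in> topspace X"
        then obtain r where r: "r \<in> A" "x \<in> F r" using cover by blast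
        obtain y where y: "r = baire_to_real y" using surjD[OF surj_baire_to_real] by blast
        then have "y \<in> Y" using r by (simp add: Y_def)
        moreover have "x \<in> H y"
          unfolding H_def
          using closure_of_subset[OF compactin_subset_topspace[OF cF[OF \<open>y \<in> Y\<close>]]] r y by blast
        ultimately show "x \<in> (\<Union>y\<in>Y. H y)" by blast
      qed
    qed
  next
    fix R :: "nat \<Rightarrow> (nat \<Rightarrow> nat) \<Rightarrow> (nat \<Rightarrow> nat) \<Rightarrow> bool" and N
    assume dep: "\<And>n x x' y y'. (\<And>i. i < N n \<Longrightarrow> x i = x' i) \<Longrightarrow> (\<And>i. i < N n \<Longrightarrow> y i = y' i) \<Longrightarrow>
              R n x y \<Longrightarrow> R n x' y'"
    have "in_hierarchy {x. \<exists>y. baire_to_real y \<in> A \<and> (\<forall>n. R n x y)}"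
      by (rule in_hierarchy_projection[OF A, where N = N]) (fact dep)
    then show "in_hierarchy {x. \<exists>y\<in>Y. \<forall>n. R n x y}"
      by (simp add: Y_def Bex_def)
  qed (use reg assms no in blast)+
  show False
    using sigma_compact assms(5) by (simp add: sigma_compact_in_def sigma_compact_space_def)
qed

end
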